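(* There exists an algorithm which takes as input $(\mathbf{a},g,\mathbf{h},F)$, where $\mathbf{a}\in\mathbb{Q}^n$, $g$ and $\mathbf{h}=(h_1,\ldots,h_l)$ are polynomials in $\mathbb{Q}[x_1,\ldots,x_n]$, and $F=(F_1,\ldots,F_k)$ is a tuple of polynomial maps $\mathbb{C}^n\to\mathbb{C}^n$ with coefficients in $\mathbb{Q}$, and which outputs True if $g\in I_{\mathcal{L}(\mathbf{a},\mathbf{h},F)}$, and False otherwise.
   Context: Notation: $\mathbf{x}=(x_1,\ldots,x_n)$, $[k]=\{1,\ldots,k\}$. For $i_1,\ldots,i_m\in[k]$, $F_{i_1,\ldots,i_m}=F_{i_m}\circ\cdots\circ F_{i_1}$, with the empty composition equal to the identity. Branching loop: $\mathcal{L}(\mathbf{a},\mathbf{h},(F_1,\ldots,F_k))$ is the loop which initializes $\mathbf{x}=\mathbf{a}$ and, while $h_1(\mathbf{x})\neq0,\ldots,h_l(\mathbf{x})\neq0$ (equivalently $h(\mathbf{x})\neq0$ with $h=h_1\cdots h_l$), nondeterministically chooses $i\in[k]$ and performs $\mathbf{x}\leftarrow F_i(\mathbf{x})$. A polynomial $g\in\mathbb{C}[\mathbf{x}]$ is a polynomial invariant of the loop if $g(\mathbf{a})=0$ and, for every $m\in\mathbb{N}$ and every $i_1,\ldots,i_m\in[k]$, either $g(F_{i_1}(\mathbf{a}))=\cdots=g(F_{i_1,\ldots,i_m}(\mathbf{a}))=0$, or there is $0\le l'<m$ such that $g(F_{i_1}(\mathbf{a}))=\cdots=g(F_{i_1,\ldots,i_{l'}}(\mathbf{a}))=0$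 and $h(F_{i_1,\ldots,i_{l'}}(\mathbf{a}))=0$. $I_{\mathcal{L}(\mathbf{a},\mathbf{h},F)}$ is the set of all polynomial invariants of the loop. *)

theory Defs
  imports Complex_Main "HOL-Library.Poly_Mapping" "HOL-Library.Nat_Bijection"
begin

section \<open>Polynomials and polynomial maps\<close>

text \<open>
  A polynomial is a finitely supported map from monomials to coefficients, and a monomial is a
  finitely supported map from variables to exponents. The variables \<open>x\<^sub>1, \<dots>, x\<^sub>n\<close> have the
  indices \<open>0, \<dots>, n - 1\<close>. Points of affine \<open>n\<close>-space are lists of length \<open>n\<close>.
\<close>

type_synonym 'a mpoly = "(nat \<Rightarrow>\<^sub>0 nat) \<Rightarrow>\<^sub>0 'a"

definition polys_in :: "nat \<Rightarrow> 'a::zero mpoly set" where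
  "polys_in n = {p. \<forall>m\<in>Poly_Mapping.keys p. Poly_Mapping.keys m \<subseteq> {..<n}}"

definition poly_eval :: "'a::comm_semiring_1 mpoly \<Rightarrow> 'a list \<Rightarrow> 'a" where
  "poly_eval p x =
     (\<Sum>m\<in>Poly_Mapping.keys p. Poly_Mapping.lookup p m *
        (\<Prod>i\<in>Poly_Mapping.keys m. (x ! i) ^ Poly_Mapping.lookup m i))"

definition complex_poly :: "rat mpoly \<Rightarrow> complex mpoly" where
  "complex_poly p = Poly_Mapping.map of_rat p"

definition map_eval :: "'a::comm_semiring_1 mpoly list \<Rightarrow> 'a list \<Rightarrow> 'a list" where
  "map_eval F x = map (\<lambda>f. poly_eval f x) F"


section \<open>Branching loops and their polynomial invariants\<close>

text \<open>
  \<^term>\<open>comp_eval Fs [i\<^sub>1, i\<^sub>2] x\<close> is \<open>F\<^bsub>i\<^sub>2\<^esub> (F\<^bsub>i\<^sub>1\<^esub> x)\<close>: the head of the index list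
  is applied first. The maps in \<open>Fs\<close> are indexed from \<open>0\<close>.
\<close>

definition comp_eval ::
  "'a::comm_semiring_1 mpoly list list \<Rightarrow> nat list \<Rightarrow> 'a list \<Rightarrow> 'a list" where
  "comp_eval Fs is x = fold (\<lambda>i. map_eval (Fs ! i)) is x"

definition is_loop_invariant ::
  "complex list \<Rightarrow> complex mpoly list \<Rightarrow> complex mpoly list list \<Rightarrow> complex mpoly \<Rightarrow> bool" where
  "is_loop_invariant a hs Fs g \<longleftrightarrow>
     poly_eval g a = 0 \<and>
     (\<forall>m. \<forall>is. length is = m \<and> set is \<subseteq> {..<length Fs} \<longrightarrow>
        (\<forall>j\<in>{1..m}. poly_eval g (comp_eval Fs (take j is) a) = 0) \<or>
        (\<exists>l<m. (\<forall>j\<in>{1..l}. poly_eval g (comp_eval Fs (take j is) a) = 0) \<and>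
               poly_eval (prod_list hs) (comp_eval Fs (take l is) a) = 0))"

definition loop_invariants ::
  "complex list \<Rightarrow> complex mpoly list \<Rightarrow> complex mpoly list list \<Rightarrow> complex mpoly set" where
  "loop_invariants a hs Fs = {g \<in> polys_in (length a). is_loop_invariant a hs Fs g}"


section \<open>Algorithms\<close>

text \<open>
  Algorithms are programs for partial recursive (\<open>\<mu>\<close>-recursive) functions on tuples of natural
  numbers. \<^term>\<open>computes P xs y\<close> means that \<open>P\<close> halts on the argument tuple \<open>xs\<close> with output
  \<open>y\<close>. A program that diverges, or is applied to a tuple of unsuitable length, computes no value.
\<close>

datatype program =
    Zero
  | Succ
  | Proj nat
  | Comp program "program list"
  | Prec program program
  | Mu program

inductive computes :: "program \<Rightarrow> nat list \<Rightarrow> nat \<Rightarrow> bool" where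
  zero: "computes Zero xs 0"
| succ: "computes Succ [x] (Suc x)"
| proj: "i < length xs \<Longrightarrow> computes (Proj i) xs (xs ! i)"
| comp: "list_all2 (\<lambda>Q y. computes Q xs y) Qs ys \<Longrightarrow> computes P ys z \<Longrightarrow>
           computes (Comp P Qs) xs z"
| prec_0: "computes P xs y \<Longrightarrow> computes (Prec P Q) (0 # xs) y"
| prec_Suc: "computes (Prec P Q) (x # xs) r \<Longrightarrow> computes Q (x # r # xs) y \<Longrightarrow>
           computes (Prec P Q) (Suc x # xs) y"
| mu: "computes P (z # xs) 0 \<Longrightarrow> (\<And>y. y < z \<Longrightarrow> \<exists>v. computes P (y # xs) (Suc v)) \<Longrightarrow>
           computes (Mu P) xs z"

inductive_cases computes_ZeroE: "computes Zero xs y"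
inductive_cases computes_SuccE: "computes Succ xs y"
inductive_cases computes_ProjE: "computes (Proj i) xs y"
inductive_cases computes_CompE: "computes (Comp P Qs) xs y"
inductive_cases computes_Prec_0E: "computes (Prec P Q) (0 # xs) y"
inductive_cases computes_Prec_SucE: "computes (Prec P Q) (Suc x # xs) y"
inductive_cases computes_MuE: "computes (Mu P) xs y"

lemma computes_deterministic:
  "computes P xs y \<Longrightarrow> computes P xs y' \<Longrightarrow> y = y'"
proof (induction arbitrary: y' rule: computes.induct)
  case (zero xs)
  then show ?case by (rule computes_ZeroE) simp
next
  case (succ x)
  then show ?case by (rule computes_SuccE) simp
next
  case (proj i xs)
  from proj.prems show ?case by (rule computes_ProjE) simp
next
  case (comp xs Qs ys P z)
  from comp.prems obtain ys' where
    *: "list_all2 (\<lambda>Q y. computes Q xs y) Qs ys'" "computes P ys' y'"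
    by (rule computes_CompE)
  have "ys = ys'"
    using comp.IH(1) *(1) by (auto simp: list_all2_conv_all_nth intro!: nth_equalityI)
  with *(2) comp.IH(2) show ?case by simp
next
  case (prec_0 P xs y Q)
  from prec_0.prems have "computes P xs y'" by (rule computes_Prec_0E)
  then show ?case by (rule prec_0.IH)
next
  case (prec_Suc P Q x xs r y)
  from prec_Suc.prems obtain r' where
    *: "computes (Prec P Q) (x # xs) r'" "computes Q (x # r' # xs) y'"
    by (rule computes_Prec_SucE)
  from *(1) have "r = r'" by (rule prec_Suc.IH)
  with *(2) show ?case using prec_Suc.IH(2) by simp
next
  case (mu P z xs)
  from mu.prems have *: "computes P (y' # xs) 0"
      "\<And>y. y < y' \<Longrightarrow> \<exists>v. computes P (y # xs) (Suc v)"
    by (rule computes_MuE, simp)+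
  have "\<not> z < y'" using *(2) mu.IH(1) by fastforce
  moreover have "\<not> y' < z" using mu.IH(2) *(1) by fastforce
  ultimately show ?case by simp
qed


section \<open>Encoding of the input\<close>

text \<open>
  Everything is encoded with the pairing, integer and list codes of
  \<^theory>\<open>HOL-Library.Nat_Bijection\<close>: a rational as its numerator and (positive) denominator in
  lowest terms, a polynomial in \<open>n\<close> variables as the ordered list of its terms, each with the
  list of its \<open>n\<close> exponents and its coefficient.
\<close>

definition rat_code :: "rat \<Rightarrow> nat" where
  "rat_code q = prod_encode (int_encode (fst (quotient_of q)), int_encode (snd (quotient_of q)))"

definition point_code :: "rat list \<Rightarrow> nat" where
  "point_code a = list_encode (map rat_code a)"

definition monomial_code :: "nat \<Rightarrow> (nat \<Rightarrow>\<^sub>0 nat) \<Rightarrow> nat" where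
  "monomial_code n m = list_encode (map (Poly_Mapping.lookup m) [0..<n])"

definition poly_code :: "nat \<Rightarrow> rat mpoly \<Rightarrow> nat" where
  "poly_code n p =
     list_encode (map (\<lambda>(m, c). prod_encode (monomial_code n m, rat_code c)) (Poly_Mapping.items p))"

definition polys_code :: "nat \<Rightarrow> rat mpoly list \<Rightarrow> nat" where
  "polys_code n ps = list_encode (map (poly_code n) ps)"

definition maps_code :: "nat \<Rightarrow> rat mpoly list list \<Rightarrow> nat" where
  "maps_code n Fs = list_encode (map (polys_code n) Fs)"

text \<open>
  For a given number of variables the codes are injective, so that they determine the input.
\<close>

lemma inj_rat_code: "inj rat_code"
proof (rule injI)
  fix p q assume "rat_code p = rat_code q"
  then have "quotient_of p = quotient_of q"
    by (simp add: rat_code_def prod_encode_eq int_encode_eq prod_eq_iff)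
  then show "p = q" by (simp add: quotient_of_inject)
qed

lemma inj_point_code: "inj point_code"
  by (rule injI) (simp add: point_code_def list_encode_eq inj_map_eq_map inj_rat_code)

lemma inj_on_monomial_code: "inj_on (monomial_code n) {m. Poly_Mapping.keys m \<subseteq> {..<n}}"
proof (rule inj_onI)
  fix m m' :: "nat \<Rightarrow>\<^sub>0 nat"
  assume *: "m \<in> {m. Poly_Mapping.keys m \<subseteq> {..<n}}" "m' \<in> {m. Poly_Mapping.keys m \<subseteq> {..<n}}"
    and "monomial_code n m = monomial_code n m'"
  then have eq: "Poly_Mapping.lookup m i = Poly_Mapping.lookup m' i" if "i < n" for i
    using that by (simp add: monomial_code_def list_encode_eq)
  have zero: "Poly_Mapping.lookup m i = 0" "Poly_Mapping.lookup m' i = 0" if "\<not> i < n" for i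
    using * that by (auto simp: in_keys_iff subset_iff)
  show "m = m'"
    by (rule poly_mapping_eqI) (metis eq zero)
qed

lemma inj_on_poly_code: "inj_on (poly_code n) (polys_in n)"
proof (rule inj_onI)
  fix p q assume *: "p \<in> polys_in n" "q \<in> polys_in n" and "poly_code n p = poly_code n q"
  let ?c = "\<lambda>(m, c). prod_encode (monomial_code n m, rat_code c)"
  let ?M = "{m. Poly_Mapping.keys m \<subseteq> {..<n}}"
  have "map ?c (Poly_Mapping.items p) = map ?c (Poly_Mapping.items q)"
    using \<open>poly_code n p = poly_code n q\<close> by (simp add: poly_code_def list_encode_eq)
  moreover have "inj_on ?c (set (Poly_Mapping.items p) \<union> set (Poly_Mapping.items q))"
  proof (rule inj_on_subset)
    show "inj_on ?c (?M \<times> UNIV)"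
      using inj_on_monomial_code[of n] inj_rat_code by (auto simp: inj_on_def prod_encode_eq)
    show "set (Poly_Mapping.items p) \<union> set (Poly_Mapping.items q) \<subseteq> ?M \<times> UNIV"
      using * by (auto simp: polys_in_def Poly_Mapping.items_def)
  qed
  ultimately have "Poly_Mapping.items p = Poly_Mapping.items q"
    by (simp add: inj_on_map_eq_map)
  then show "p = q"
    by (metis the_value_items)
qed

lemma inj_on_polys_code: "inj_on (polys_code n) (lists (polys_in n))"
proof (rule inj_onI)
  fix ps qs assume *: "ps \<in> lists (polys_in n)" "qs \<in> lists (polys_in n)"
    and "polys_code n ps = polys_code n qs"
  then have "map (poly_code n) ps = map (poly_code n) qs" by (simp add: polys_code_def list_encode_eq)
  moreover have "inj_on (poly_code n) (set ps \<union> set qs)"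
    using * by (intro inj_on_subset[OF inj_on_poly_code]) auto
  ultimately show "ps = qs" by (simp add: inj_on_map_eq_map)
qed

lemma inj_on_maps_code: "inj_on (maps_code n) (lists (lists (polys_in n)))"
proof (rule inj_onI)
  fix Fs Gs assume *: "Fs \<in> lists (lists (polys_in n))" "Gs \<in> lists (lists (polys_in n))"
    and "maps_code n Fs = maps_code n Gs"
  then have "map (polys_code n) Fs = map (polys_code n) Gs" by (simp add: maps_code_def list_encode_eq)
  moreover have "inj_on (polys_code n) (set Fs \<union> set Gs)"
    using * by (intro inj_on_subset[OF inj_on_polys_code]) auto
  ultimately show "Fs = Gs" by (simp add: inj_on_map_eq_map)
qed

end

theory Submission
  imports Defs "HOL-Library.Function_Algebras" "HOL-Library.More_List"
    "HOL-Computational_Algebra.Polynomial"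
begin

text \<open>
  For a word \<open>w\<close> of indices let \<open>p\<^sub>w\<close> be the polynomial with \<open>p\<^sub>\<epsilon> = g\<close> and
  \<open>p\<^bsub>i w\<^esub> = h * (p\<^sub>w \<circ> F\<^sub>i)\<close>. Then \<open>g\<close> is an invariant iff every \<open>p\<^sub>w\<close> vanishes at \<open>a\<close>. By
  Hilbert's basis theorem the ideal of all \<open>p\<^sub>w\<close> is generated by \<open>g\<close> and finitely many
  polynomials \<open>q\<^sub>j\<close> among them, so that each \<open>h * (q\<^sub>j \<circ> F\<^sub>i)\<close> is an explicit polynomial combination
  of the generators. Conversely, finitely many polynomials that include \<open>g\<close>, vanish at \<open>a\<close>
  and satisfy such identities certify that \<open>g\<close> is an invariant. Hence an unbounded search through all
  words \<open>w\<close> and all certificates terminates and decides the problem. No ideal membership has to be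
  decided: checking a certificate only requires polynomial arithmetic.
\<close>


section \<open>Computable functions on encoded types\<close>

text \<open>The factor \<open>h\<close> makes a run that has already left the loop contribute 0, so
  that invariance becomes the vanishing of all word polynomials at the single point
  \<open>a\<close>. The number of variables is a value and not a type; polynomial rings are
  therefore taken as subrings of one fixed ring of functions on rational sequences, and lists of
  terms are compared with functions by using that the rationals are infinite. The search runs
  through all natural numbers, each of which must be the code of a candidate. Codes of reduced
  fractions do not exhaust the naturals, so certificates have triples of naturals as coefficients.
  The search must also halt on every encoded value, well formed or not, hence the dichotomy between
  refutations and certificates is proved for arbitrary lists of terms. All this happens over the
  rationals; the complex numbers enter only through the injectivity of
  \<open>of_rat\<close>.\<close>

class encodable =
  fixes encode :: "'a \<Rightarrow> nat"

instantiation nat :: encodable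
begin
definition encode_nat :: "nat \<Rightarrow> nat" where [simp]: "encode_nat n = n"
instance ..
end

instantiation bool :: encodable
begin
definition encode_bool :: "bool \<Rightarrow> nat" where "encode_bool b = (if b then 1 else 0)"
instance ..
end

instantiation rat :: encodable
begin
definition encode_rat :: "rat \<Rightarrow> nat" where "encode_rat = rat_code"
instance ..
end

instantiation prod :: (encodable, encodable) encodable
begin
definition encode_prod :: "'a \<times> 'b \<Rightarrow> nat" where
  "encode_prod p = prod_encode (encode (fst p), encode (snd p))"
instance ..
end

instantiation list :: (encodable) encodable
begin
definition encode_list :: "'a list \<Rightarrow> nat" where
  "encode_list xs = list_encode (map encode xs)"
instance ..
end

lemma surj_encode_nat: "surj (encode :: nat \<Rightarrow> nat)"
  by (rule surjI[of _ id]) simp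

lemma surj_encode_prod:
  assumes "surj (encode :: 'a::encodable \<Rightarrow> nat)" "surj (encode :: 'b::encodable \<Rightarrow> nat)"
  shows "surj (encode :: 'a \<times> 'b \<Rightarrow> nat)"
proof (rule surjI)
  fix n
  show "encode (inv encode (fst (prod_decode n)) :: 'a, inv encode (snd (prod_decode n)) :: 'b) = n"
    using assms by (simp add: encode_prod_def surj_f_inv_f)
qed

lemma surj_encode_list:
  assumes "surj (encode :: 'a::encodable \<Rightarrow> nat)"
  shows "surj (encode :: 'a list \<Rightarrow> nat)"
proof (rule surjI)
  fix n
  show "encode (map (inv encode) (list_decode n) :: 'a list) = n"
    using assms by (simp add: encode_list_def o_def surj_f_inv_f)
qed

text \<open>\<open>encode\<close> is not assumed injective; computability forces the code of
  \<open>f x\<close> to depend only on the code of \<open>x\<close>.\<close>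

definition computable :: "('a::encodable \<Rightarrow> 'b::encodable) \<Rightarrow> bool" where
  "computable f \<longleftrightarrow> (\<exists>P. \<forall>x. computes P [encode x] (encode (f x)))"

text \<open>Programs on raw pairs of arguments are needed until pairing itself is known to be
  computable. Unary functions receive a dummy second argument.\<close>

definition computable2 :: "(nat \<Rightarrow> nat \<Rightarrow> nat) \<Rightarrow> bool" where
  "computable2 h \<longleftrightarrow> (\<exists>P. \<forall>x y. computes P [x, y] (h x y))"

named_theorems computable_intros

lemma computes_comp1: "computes Q xs y \<Longrightarrow> computes P [y] z \<Longrightarrow> computes (Comp P [Q]) xs z"
  by (rule computes.comp[of _ _ "[y]"]) auto

lemma computes_comp2:
  "computes Q xs y \<Longrightarrow> computes R xs z \<Longrightarrow> computes P [y, z] v \<Longrightarrow> computes (Comp P [Q, R]) xs v"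
  by (rule computes.comp[of _ _ "[y, z]"]) auto

lemma computes_proj: "i < length xs \<Longrightarrow> y = xs ! i \<Longrightarrow> computes (Proj i) xs y"
  by (simp add: computes.proj)

lemma computes_Prec_rec_nat:
  assumes "computes P xs p" "\<And>k r. k < n \<Longrightarrow> r = rec_nat p q k \<Longrightarrow> computes Q (k # r # xs) (q k r)"
  shows "computes (Prec P Q) (n # xs) (rec_nat p q n)"
  using assms(2)
proof (induction n)
  case 0
  then show ?case by (simp add: computes.prec_0 assms(1))
next
  case (Suc n)
  then show ?case by (auto intro: computes.prec_Suc)
qed

lemma computableI: "(\<And>x. computes P [encode x] (encode (f x))) \<Longrightarrow> computable f"
  unfolding computable_def by blast

lemma computableE:
  assumes "computable f"
  obtains P where "\<And>x. computes P [encode x] (encode (f x))"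
  using assms unfolding computable_def by blast

lemma computable2E:
  assumes "computable2 h"
  obtains P where "\<And>x y. computes P [x, y] (h x y)"
  using assms unfolding computable2_def by blast

lemma computable_id [computable_intros]: "computable (\<lambda>e. e)"
  by (rule computableI[of "Proj 0"]) (simp add: computes_proj)

lemma computable_compose: "computable g \<Longrightarrow> computable f \<Longrightarrow> computable (\<lambda>e. g (f e))"
  by (erule computableE, erule computableE, rule computableI, rule computes_comp1)

lemma computable_nat_const: "\<exists>P. \<forall>xs. computes P xs c"
proof (induction c)
  case 0
  show ?case using computes.zero by blast
next
  case (Suc c)
  then obtain P where "\<forall>xs. computes P xs c" ..
  then have "\<forall>xs. computes (Comp Succ [P]) xs (Suc c)"
    using computes_comp1 computes.succ by blast
  then show ?case ..
qed

lemma computable_const [computable_intros]: "computable (\<lambda>e. c)"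
proof -
  obtain P where "\<forall>xs. computes P xs (encode c)" using computable_nat_const ..
  then show ?thesis by (intro computableI[of P]) simp
qed

lemma computable_Suc [computable_intros]:
  "computable f \<Longrightarrow> computable (\<lambda>e. Suc (f e))"
  by (erule computableE, rule computableI, rule computes_comp1, assumption)
    (simp, rule computes.succ)

lemma computable_binop:
  "computable2 h \<Longrightarrow> computable f \<Longrightarrow> computable g \<Longrightarrow> computable (\<lambda>e. h (f e) (g e))"
  by (erule computableE, erule computableE, erule computable2E, rule computableI,
      rule computes_comp2, assumption, assumption) simp

text \<open>\<open>Prec\<close> recurses on the head of the tuple, which is why subtraction is set
  up with the subtrahend in front.\<close>

lemma computable2_rec_nat:
  assumes "\<forall>y. computes P [y] (p y)" "\<forall>k r y. computes Q [k, r, y] (q k r)"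
  shows "computable2 (\<lambda>n y. rec_nat (p y) q n)"
  unfolding computable2_def using assms
  by (intro exI[of _ "Prec P Q"] allI computes_Prec_rec_nat) auto

section \<open>Arithmetic and the pairing function\<close>

lemma computable2_add: "computable2 (+)"
proof -
  have "computable2 (\<lambda>n y. rec_nat y (\<lambda>k r. Suc r) n)"
    by (rule computable2_rec_nat[where P = "Proj 0" and Q = "Comp Succ [Proj 1]"])
      (auto intro!: computes_proj computes_comp1 computes.succ)
  moreover have "rec_nat y (\<lambda>k r. Suc r) n = n + y" for n y :: nat
    by (induction n) auto
  ultimately show ?thesis by simp
qed

lemmas computable_add [computable_intros] = computable_binop[OF computable2_add]

lemma computable2_pred: "computable2 (\<lambda>n y. n - 1)"
proof -
  have "computable2 (\<lambda>n y. rec_nat 0 (\<lambda>k r. k) n)"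
    by (rule computable2_rec_nat[where P = Zero and Q = "Proj 0"])
      (auto intro!: computes_proj computes.zero)
  moreover have "rec_nat 0 (\<lambda>k r. k) n = n - 1" for n :: nat
    by (induction n) auto
  ultimately show ?thesis by simp
qed

lemma computable2_diff: "computable2 (\<lambda>n y. y - n)"
proof -
  obtain P where P: "\<And>x y. computes P [x, y] (x - 1)"
    using computable2_pred unfolding computable2_def by blast
  have "computable2 (\<lambda>n y. rec_nat y (\<lambda>k r. r - 1) n)"
    by (rule computable2_rec_nat[where P = "Proj 0" and Q = "Comp P [Proj 1, Proj 1]"])
      (auto intro!: computes_proj computes_comp2[OF _ _ P[unfolded One_nat_def]])
  moreover have "rec_nat y (\<lambda>k r. r - 1) n = y - n" for n y :: nat
    by (induction n) auto
  ultimately show ?thesis by simp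
qed

lemma computable_diff [computable_intros]:
  "computable f \<Longrightarrow> computable g \<Longrightarrow> computable (\<lambda>e. f e - g e :: nat)"
  by (rule computable_binop[OF computable2_diff])

lemma computable2_triangle: "computable2 (\<lambda>n y. triangle n)"
proof -
  obtain P where P: "\<And>x y. computes P [x, y] (x + y)"
    using computable2_add unfolding computable2_def by blast
  have "computable2 (\<lambda>n y. rec_nat 0 (\<lambda>k r. r + Suc k) n)"
    by (rule computable2_rec_nat[where P = Zero and Q = "Comp P [Proj 1, Comp Succ [Proj 0]]"])
      (rule allI computes.zero computes_proj computes.succ computes_comp1
        computes_comp2[OF _ _ P] | simp del: add_Suc_right)+
  moreover have "rec_nat 0 (\<lambda>k r. r + Suc k) n = triangle n" for n :: nat
    by (induction n) auto
  ultimately show ?thesis by simp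
qed

lemma computable_triangle:
  "computable f \<Longrightarrow> computable (\<lambda>e. triangle (f e))"
  by (rule computable_binop[OF computable2_triangle])

lemma computable2_prod_encode: "computable2 (\<lambda>x y. prod_encode (x, y))"
proof -
  obtain A where A: "\<And>x y. computes A [x, y] (x + y)"
    using computable2_add unfolding computable2_def by blast
  obtain T where T: "\<And>x y. computes T [x, y] (triangle x)"
    using computable2_triangle unfolding computable2_def by blast
  show ?thesis
    unfolding computable2_def prod_encode_def prod.case
    by (intro exI[of _ "Comp A [Comp T [A, A], Proj 0]"] allI)
      (rule computes_comp2[OF computes_comp2[OF A A T] computes_proj A]; simp)
qed

lemmas computable_prod_encode = computable_binop[OF computable2_prod_encode]

text \<open>The diagonal \<open>m + n\<close> containing \<open>prod_encode (m, n)\<close> is found by unbounded search.\<close>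

definition diagonal :: "nat \<Rightarrow> nat" where
  "diagonal z = fst (prod_decode z) + snd (prod_decode z)"

lemma mono_triangle: "m \<le> n \<Longrightarrow> triangle m \<le> triangle n"
  by (induction rule: dec_induct) auto

text \<open>\<open>prod_encode (m, n)\<close> is \<open>triangle (m + n) + m\<close>, and
  \<open>m\<close> is too small to reach the next triangular number.\<close>

lemma diagonal_bounds: "triangle (diagonal z) \<le> z" "z < triangle (Suc (diagonal z))"
proof -
  obtain m n where "z = prod_encode (m, n)"
    by (metis prod_decode_inverse surj_pair)
  then show "triangle (diagonal z) \<le> z" "z < triangle (Suc (diagonal z))"
    by (simp_all add: diagonal_def) (simp_all add: prod_encode_def)
qed

text \<open>By \<open>diagonal_bounds\<close> the diagonal is the least \<open>k\<close> with
  \<open>z < triangle (Suc k)\<close>, that is, the least zero of the truncated difference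
  \<open>Suc z - triangle (Suc k)\<close>, as \<open>Mu\<close> requires.\<close>

lemma computable_diagonal: "computable f \<Longrightarrow> computable (\<lambda>e. diagonal (f e))"
proof -
  obtain D where D: "\<And>x y. computes D [x, y] (y - x)"
    using computable2_diff unfolding computable2_def by blast
  obtain T where T: "\<And>x y. computes T [x, y] (triangle x)"
    using computable2_triangle unfolding computable2_def by blast
  let ?P = "Comp D [Comp T [Comp Succ [Proj 0], Proj 0], Comp Succ [Proj 1]]"
  have P: "computes ?P [k, z] (Suc z - triangle (Suc k))" for k z
    by (rule computes_comp2[OF _ _ D] computes_comp2[OF _ _ T] computes_comp1 computes.succ
        computes_proj | simp)+
  have *: "Suc z - triangle (Suc k) > 0" if "k < diagonal z" for k z
    using diagonal_bounds(1)[of z] mono_triangle[of "Suc k" "diagonal z"] that by simp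
  have "computes (Mu ?P) [encode z] (encode (diagonal z))" for z
    unfolding encode_nat_def
  proof (rule computes.mu)
    show "computes ?P [diagonal z, z] 0"
      using P[of "diagonal z" z] diagonal_bounds(2)[of z] by simp
    show "\<exists>v. computes ?P [k, z] (Suc v)" if "k < diagonal z" for k
      using P[of k z] *[OF that] by (metis Suc_pred)
  qed
  then show "computable f \<Longrightarrow> computable (\<lambda>e. diagonal (f e))"
    by (rule computable_compose[OF computableI])
qed

lemma fst_prod_decode: "fst (prod_decode z) = z - triangle (diagonal z)"
proof -
  obtain m n where "z = prod_encode (m, n)"
    by (metis prod_decode_inverse surj_pair)
  then show ?thesis by (simp add: diagonal_def) (simp add: prod_encode_def)
qed

lemma snd_prod_decode: "snd (prod_decode z) = diagonal z - fst (prod_decode z)"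
  by (simp add: diagonal_def)

lemma computable_prod_decode:
  assumes "computable f"
  shows "computable (\<lambda>e. fst (prod_decode (f e)))" "computable (\<lambda>e. snd (prod_decode (f e)))"
  unfolding snd_prod_decode fst_prod_decode
  by (intro computable_intros computable_triangle computable_diagonal assms)+

text \<open>\<open>encode\<close> is the identity on numbers, so operations on structured types can
  be verified as arithmetic on codes.\<close>

lemma computable_encode_iff: "computable (\<lambda>e. encode (f e)) \<longleftrightarrow> computable f"
  by (simp add: computable_def)

lemmas computable_encode [computable_intros] = iffD2[OF computable_encode_iff]

lemma computable_Pair [computable_intros]:
  "computable f \<Longrightarrow> computable g \<Longrightarrow> computable (\<lambda>e. (f e, g e))"
  by (subst computable_encode_iff[symmetric], unfold encode_prod_def fst_conv snd_conv)
    (intro computable_prod_encode computable_encode)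

lemma computable_fst [computable_intros]: "computable f \<Longrightarrow> computable (\<lambda>e. fst (f e))"
  using computable_prod_decode(1)[OF computable_encode, of f]
  by (subst computable_encode_iff[symmetric]) (simp add: encode_prod_def)

lemma computable_snd [computable_intros]: "computable f \<Longrightarrow> computable (\<lambda>e. snd (f e))"
  using computable_prod_decode(2)[OF computable_encode, of f]
  by (subst computable_encode_iff[symmetric]) (simp add: encode_prod_def)

section \<open>Recursion, case distinction and search\<close>

lemma computable_rec_nat [computable_intros]:
  assumes "computable n" "computable f" "computable (\<lambda>p. g (fst p) (fst (snd p)) (snd (snd p)))"
  shows "computable (\<lambda>e. rec_nat (f e) (\<lambda>k r. g e k r) (n e))"
proof -
  obtain N where N: "\<And>e. computes N [encode e] (n e)"
    using assms(1) by (auto simp: computable_def)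
  obtain F where F: "\<And>e. computes F [encode e] (encode (f e))"
    using assms(2) by (auto simp: computable_def)
  obtain G where "\<And>p. computes G [encode p] (encode (g (fst p) (fst (snd p)) (snd (snd p))))"
    using assms(3) unfolding computable_def by blast
  then have G: "computes G [prod_encode (encode e, prod_encode (k, encode r))] (encode (g e k r))"
    for e k r
    by (metis encode_nat_def encode_prod_def fst_conv snd_conv)
  obtain C where C: "\<And>x y. computes C [x, y] (prod_encode (x, y))"
    using computable2_prod_encode unfolding computable2_def by blast
  \<comment> \<open>The tuple of \<open>Prec\<close> holds counter, previous value and environment;
    it is repacked into the single code of \<open>(e, k, r)\<close> that \<open>G\<close>
    expects.\<close>
  let ?Q = "Comp G [Comp C [Proj 2, Comp C [Proj 0, Proj 1]]]"
  have Q: "computes ?Q [k, encode r, encode e] (encode (g e k r))" for k r e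
    by (rule computes_comp1[OF _ G] computes_comp2[OF _ _ C] computes_proj | simp)+
  have *: "computes (Prec F ?Q) [m, encode e] (encode (rec_nat (f e) (g e) m))" for m e
  proof (induction m)
    case 0
    show ?case by (simp add: computes.prec_0 F)
  next
    case (Suc m)
    then show ?case using computes.prec_Suc[OF Suc Q] by simp
  qed
  have "computes (Comp (Prec F ?Q) [N, Proj 0]) [encode e] (encode (rec_nat (f e) (g e) (n e)))"
    for e
    by (rule computes_comp2[OF N computes_proj *]) simp_all
  then show ?thesis by (rule computableI)
qed

text \<open>Recursion on the code of \<open>b e\<close>, which is 0 or 1: the base value is the else
  branch, and the only possible step overwrites it.\<close>

lemma computable_if [computable_intros]:
  assumes "computable b" "computable f" "computable g"
  shows "computable (\<lambda>e. if b e then f e else g e)"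
proof -
  have "computable (\<lambda>e. rec_nat (g e) (\<lambda>_ _. f e) (encode (b e)))"
    by (intro computable_intros computable_compose[OF assms(2)] assms)
  moreover have "rec_nat (g e) (\<lambda>_ _. f e) (encode (b e)) = (if b e then f e else g e)" for e
    by (simp add: encode_bool_def)
  ultimately show ?thesis by simp
qed

lemma computable_less [computable_intros]:
  assumes "computable f" "computable g"
  shows "computable (\<lambda>e. f e < (g e :: nat))"
proof -
  have "computable (\<lambda>e. rec_nat 0 (\<lambda>_ _. Suc 0) (g e - f e))"
    by (intro computable_intros assms)
  moreover have "rec_nat 0 (\<lambda>_ _. Suc 0) (g e - f e) = encode (f e < g e)" for e
    by (cases "g e - f e") (auto simp: encode_bool_def)
  ultimately show ?thesis by (simp add: computable_encode_iff)
qed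

lemma computable_Not [computable_intros]: "computable f \<Longrightarrow> computable (\<lambda>e. \<not> f e)"
  by (rule back_subst[of computable, OF computable_if[of f "\<lambda>_. False" "\<lambda>_. True"]])
    (auto simp: computable_const)

lemma computable_conj [computable_intros]:
  "computable f \<Longrightarrow> computable g \<Longrightarrow> computable (\<lambda>e. f e \<and> g e)"
  by (rule back_subst[of computable, OF computable_if[of f g "\<lambda>_. False"]])
    (auto simp: computable_const)

lemma computable_disj [computable_intros]:
  "computable f \<Longrightarrow> computable g \<Longrightarrow> computable (\<lambda>e. f e \<or> g e)"
  by (rule back_subst[of computable, OF computable_if[of f "\<lambda>_. True" g]])
    (auto simp: computable_const)

lemma computable_eq_nat [computable_intros]:
  assumes "computable f" "computable g"
  shows "computable (\<lambda>e. f e = (g e :: nat))"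
proof -
  have "computable (\<lambda>e. \<not> f e < g e \<and> \<not> g e < f e)"
    by (intro computable_intros assms)
  moreover have "\<not> f e < g e \<and> \<not> g e < f e \<longleftrightarrow> f e = g e" for e
    by auto
  ultimately show ?thesis by simp
qed

lemma computable_mult [computable_intros]:
  assumes "computable f" "computable g"
  shows "computable (\<lambda>e. f e * g e :: nat)"
proof -
  have "computable (\<lambda>e. rec_nat 0 (\<lambda>_ r. r + g e) (f e))"
    by (intro computable_intros computable_compose[OF assms(2)] assms)
  moreover have "rec_nat 0 (\<lambda>_ r. r + m) n = n * m" for n m :: nat
    by (induction n) auto
  ultimately show ?thesis by simp
qed

text \<open>\<open>Mu\<close> finds the least code of a witness. Surjectivity of
  \<open>encode\<close> makes every number tried the code of a candidate.\<close>

lemma computable_search: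
  fixes b :: "'a::encodable \<Rightarrow> 'b::encodable \<Rightarrow> bool"
  assumes b: "computable (\<lambda>p. b (fst p) (snd p))"
    and surj: "surj (encode :: 'b \<Rightarrow> nat)" and ex: "\<And>e. \<exists>z. b e z"
  shows "\<exists>f. computable f \<and> (\<forall>e. b e (f e))"
proof -
  have "computable (\<lambda>p. if b (fst p) (snd p) then 0 else Suc 0)"
    by (intro computable_intros b)
  then obtain B where B: "\<And>p. computes B [encode p] (if b (fst p) (snd p) then 0 else Suc 0)"
    unfolding computable_def encode_nat_def by blast
  obtain C where C: "\<And>x y. computes C [x, y] (prod_encode (x, y))"
    using computable2_prod_encode unfolding computable2_def by blast
  let ?P = "Comp B [Comp C [Proj 1, Proj 0]]"
  have P: "computes ?P [encode z, encode e] (if b e z then 0 else Suc 0)" for z e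
    using B[of "(e, z)"]
    by (auto intro!: computes_comp1[of _ _ "encode (e, z)"] computes_comp2[OF _ _ C] computes_proj
        simp: encode_prod_def)
  define d :: "nat \<Rightarrow> 'b" where "d = inv encode"
  have d: "encode (d n) = n" for n
    using surj by (simp add: d_def surj_f_inv_f)
  have P': "computes ?P [n, encode e] (if b e (d n) then 0 else Suc 0)" for n e
    using P[of "d n" e] by (simp add: d)
  define f where "f e = d (LEAST n. b e (d n))" for e
  have ex': "\<exists>n. b e (d n)" for e
  proof -
    obtain z where "b e z" using ex by blast
    \<comment> \<open>\<open>z\<close> and \<open>d (encode z)\<close> may differ but have the same
      code, so determinism of the program for \<open>b\<close> gives the same answer for
      both.\<close>
    then have "b e (d (encode z))"
      using computes_deterministic[OF P[of z e] P'[of "encode z" e]] by (simp split: if_splits)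
    then show ?thesis ..
  qed
  have "computes (Mu ?P) [encode e] (encode (f e))" for e
    unfolding f_def d
  proof (rule computes.mu)
    show "computes ?P [LEAST n. b e (d n), encode e] 0"
      using P'[of "LEAST n. b e (d n)" e] LeastI_ex[OF ex'[of e]] by simp
    show "\<exists>v. computes ?P [n, encode e] (Suc v)" if "n < (LEAST n. b e (d n))" for n
      using P'[of n e] not_less_Least[OF that] by auto
  qed
  then have "computable f" by (rule computableI)
  moreover have "b e (f e)" for e
    unfolding f_def by (rule LeastI_ex[OF ex'])
  ultimately show ?thesis by blast
qed

section \<open>Lists\<close>

lemma computable_Cons [computable_intros]:
  assumes "computable f" "computable g"
  shows "computable (\<lambda>e. f e # g e)"
proof -
  have "computable (\<lambda>e. Suc (encode (f e, g e)))"
    by (intro computable_intros assms)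
  moreover have "Suc (encode (f e, g e)) = encode (f e # g e)" for e
    by (simp add: encode_prod_def encode_list_def)
  ultimately show ?thesis by (simp add: computable_encode_iff)
qed

text \<open>A recursion of depth 0 or 1, according to emptiness. What \<open>T\<close> computes is
  the pair code of head and tail only for a nonempty list, and only then does the step program call
  it.\<close>

lemma computable_case_list [computable_intros]:
  assumes "computable l" "computable f" "computable (\<lambda>p. g (fst p) (fst (snd p)) (snd (snd p)))"
  shows "computable (\<lambda>e. case l e of [] \<Rightarrow> f e | x # xs \<Rightarrow> g e x xs)"
proof -
  have "computable (\<lambda>e. if encode (l e) = 0 then 0 else Suc 0)"
    by (intro computable_intros assms)
  then obtain S where S: "\<And>e. computes S [encode e] (if encode (l e) = 0 then 0 else Suc 0)"
    unfolding computable_def encode_nat_def by blast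
  have "computable (\<lambda>e. encode (l e) - 1)"
    by (intro computable_intros assms)
  then obtain T where T: "\<And>e. computes T [encode e] (encode (l e) - 1)"
    unfolding computable_def encode_nat_def by blast
  obtain F where F: "\<And>e. computes F [encode e] (encode (f e))"
    using assms(2) unfolding computable_def by blast
  obtain G where "\<And>p. computes G [encode p] (encode (g (fst p) (fst (snd p)) (snd (snd p))))"
    using assms(3) unfolding computable_def by blast
  then have G: "computes G [prod_encode (encode e, prod_encode (encode x, encode xs))] (encode (g e x xs))"
    for e x xs
    by (metis encode_prod_def fst_conv snd_conv)
  obtain C where C: "\<And>x y. computes C [x, y] (prod_encode (x, y))"
    using computable2_prod_encode unfolding computable2_def by blast
  let ?Q = "Comp G [Comp C [Proj 2, Comp T [Proj 2]]]"
  have "computes (Comp (Prec F ?Q) [S, Proj 0]) [encode e]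
      (encode (case l e of [] \<Rightarrow> f e | x # xs \<Rightarrow> g e x xs))" for e
  proof (cases "l e")
    case Nil
    then have "computes S [encode e] 0" using S[of e] by (simp add: encode_list_def)
    from computes_comp2[OF this computes_proj computes.prec_0[OF F]] show ?thesis
      by (simp add: Nil)
  next
    case (Cons x xs)
    then have 1: "computes S [encode e] (Suc 0)"
      and 2: "computes T [encode e] (prod_encode (encode x, encode xs))"
      using S[of e] T[of e] by (simp_all add: encode_list_def)
    have "computes ?Q [0, encode (f e), encode e] (encode (g e x xs))"
      by (rule computes_comp1[OF _ G] computes_comp2[OF _ _ C] computes_comp1[OF _ 2]
          computes_proj | simp)+
    then have "computes (Prec F ?Q) [Suc 0, encode e] (encode (g e x xs))"
      by (rule computes.prec_Suc[OF computes.prec_0[OF F]])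
    then show ?thesis
      by (intro computes_comp2[OF 1 computes_proj]) (simp_all add: Cons)
  qed
  then show ?thesis by (rule computableI)
qed

text \<open>Lets the code of a list serve as the number of steps when a fold is run by recursion on
  numbers.\<close>

lemma length_le_encode: "length xs \<le> encode xs"
proof (induction xs)
  case (Cons x xs)
  then show ?case
    using le_prod_encode_2[of "encode xs" "encode x"] by (simp add: encode_list_def)
qed simp

text \<open>The state is the unread part of the list with the accumulator; once the list is
  exhausted, further steps change nothing.\<close>

lemma rec_nat_fold:
  assumes "length xs \<le> n"
  shows "rec_nat (xs, s) (\<lambda>_ r. case fst r of [] \<Rightarrow> r | x # ys \<Rightarrow> (ys, f x (snd r))) n =
    ([], fold f xs s)"
proof -
  let ?step = "\<lambda>r. case fst r of [] \<Rightarrow> r | x # ys \<Rightarrow> (ys, f x (snd r))"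
  have "rec_nat (xs, s) (\<lambda>_. ?step) k = (drop k xs, fold f (take k xs) s)" for k
  proof (induction k)
    case (Suc k)
    show ?case
    proof (cases "k < length xs")
      case True
      then have "drop k xs = xs ! k # drop (Suc k) xs" by (simp add: Cons_nth_drop_Suc)
      then show ?thesis using True Suc by (simp add: take_Suc_conv_app_nth)
    qed (simp add: Suc)
  qed simp
  then show ?thesis using assms by simp
qed

lemma computable_fold [computable_intros]:
  assumes "computable l" "computable s" "computable (\<lambda>p. g (fst p) (fst (snd p)) (snd (snd p)))"
  shows "computable (\<lambda>e. fold (\<lambda>x r. g e x r) (l e) (s e))"
proof -
  \<comment> \<open>The hypothesis on \<open>g\<close> for arbitrary computable arguments, since
    \<open>g\<close> is applied to parts of the recursion state.\<close>
  have *: "computable (\<lambda>p. g (h p) (h1 p) (h2 p))"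
    if "computable h" "computable h1" "computable h2" for h h1 h2
    using computable_compose[OF assms(3) computable_Pair[OF that(1) computable_Pair[OF that(2,3)]]]
    by simp
  then have "computable (\<lambda>e. snd (rec_nat (l e, s e)
      (\<lambda>_ r. case fst r of [] \<Rightarrow> r | x # ys \<Rightarrow> (ys, g e x (snd r))) (encode (l e))))"
    by (intro * computable_intros assms(1,2))
  then show ?thesis by (simp add: rec_nat_fold length_le_encode)
qed

lemma computable_rev [computable_intros]:
  assumes "computable l"
  shows "computable (\<lambda>e. rev (l e))"
proof -
  have "computable (\<lambda>e. fold (\<lambda>x r. x # r) (l e) [])"
    by (intro computable_intros assms)
  then show ?thesis by (simp add: fold_Cons_rev)
qed

lemma computable_foldr [computable_intros]:
  assumes "computable l" "computable s" "computable (\<lambda>p. g (fst p) (fst (snd p)) (snd (snd p)))"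
  shows "computable (\<lambda>e. foldr (\<lambda>x r. g e x r) (l e) (s e))"
  unfolding foldr_conv_fold by (intro computable_intros assms)

lemma computable_map [computable_intros]:
  assumes "computable l" "computable (\<lambda>p. g (fst p) (snd p))"
  shows "computable (\<lambda>e. map (\<lambda>x. g e x) (l e))"
proof -
  have *: "computable (\<lambda>p. g (h p) (h1 p))" if "computable h" "computable h1" for h h1
    using computable_compose[OF assms(2) computable_Pair[OF that]] by simp
  then have "computable (\<lambda>e. foldr (\<lambda>x r. g e x # r) (l e) [])"
    by (intro * computable_intros assms(1))
  moreover have "foldr (\<lambda>x r. g e x # r) xs [] = map (\<lambda>x. g e x) xs" for e xs
    by (induction xs) auto
  ultimately show ?thesis by simp
qed

lemma computable_list_all [computable_intros]:
  assumes "computable l" "computable (\<lambda>p. g (fst p) (snd p))"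
  shows "computable (\<lambda>e. list_all (\<lambda>x. g e x) (l e))"
proof -
  have *: "computable (\<lambda>p. g (h p) (h1 p))" if "computable h" "computable h1" for h h1
    using computable_compose[OF assms(2) computable_Pair[OF that]] by simp
  then have "computable (\<lambda>e. foldr (\<lambda>x r. g e x \<and> r) (l e) True)"
    by (intro * computable_intros assms(1))
  moreover have "foldr (\<lambda>x r. g e x \<and> r) xs True = list_all (\<lambda>x. g e x) xs" for e xs
    by (induction xs) auto
  ultimately show ?thesis by simp
qed

lemma computable_list_ex [computable_intros]:
  assumes "computable l" "computable (\<lambda>p. g (fst p) (snd p))"
  shows "computable (\<lambda>e. list_ex (\<lambda>x. g e x) (l e))"
proof -
  have "computable (\<lambda>e. \<not> list_all (\<lambda>x. \<not> g e x) (l e))"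
    by (intro computable_intros assms)
  then show ?thesis by (simp add: list_ex_iff list_all_iff)
qed

lemma computable_append [computable_intros]:
  assumes "computable f" "computable g"
  shows "computable (\<lambda>e. f e @ g e)"
proof -
  have "computable (\<lambda>e. foldr (\<lambda>x r. x # r) (f e) (g e))"
    by (intro computable_intros assms)
  moreover have "foldr (\<lambda>x r. x # r) xs ys = xs @ ys" for xs ys :: "'b list"
    by (induction xs) auto
  ultimately show ?thesis by simp
qed

lemma computable_concat [computable_intros]:
  assumes "computable f"
  shows "computable (\<lambda>e. concat (f e))"
  unfolding concat_conv_foldr by (intro computable_intros assms)

lemma computable_length [computable_intros]:
  assumes "computable f"
  shows "computable (\<lambda>e. length (f e))"
proof -
  have "computable (\<lambda>e. foldr (\<lambda>_ n. Suc n) (f e) 0)"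
    by (intro computable_intros assms)
  moreover have "foldr (\<lambda>_ n. Suc n) xs 0 = length xs" for xs :: "'b list"
    by (induction xs) auto
  ultimately show ?thesis by simp
qed

lemma computable_upt [computable_intros]:
  assumes "computable f"
  shows "computable (\<lambda>e. [0..<f e])"
proof -
  have "computable (\<lambda>e. rec_nat [] (\<lambda>k r. r @ [k]) (f e))"
    by (intro computable_intros assms)
  moreover have "rec_nat [] (\<lambda>k r. r @ [k]) n = [0..<n]" for n
    by (induction n) auto
  ultimately show ?thesis by simp
qed

text \<open>Iterated tail, then head. \<open>nth_default\<close> takes the place of
  \<open>!\<close>, whose value outside the list is unspecified.\<close>

lemma computable_nth_default [computable_intros]:
  assumes "computable f" "computable i"
  shows "computable (\<lambda>e. nth_default d (f e) (i e))"
proof -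
  have "computable (\<lambda>e. case rec_nat (f e) (\<lambda>_ r. case r of [] \<Rightarrow> [] | _ # ys \<Rightarrow> ys) (i e) of
      [] \<Rightarrow> d | x # _ \<Rightarrow> x)"
    by (intro computable_intros assms)
  moreover have "rec_nat xs (\<lambda>_ r. case r of [] \<Rightarrow> [] | _ # ys \<Rightarrow> ys) n = drop n xs"
    for n and xs :: "'b list"
  proof (induction n)
    case (Suc n)
    then show ?case by (cases "drop n xs") (simp_all add: drop_Suc drop_tl)
  qed simp
  moreover have "(case drop n xs of [] \<Rightarrow> d | x # _ \<Rightarrow> x) = nth_default d xs n"
    for n and xs :: "'b list"
    by (cases "n < length xs") (simp_all add: nth_default_def Cons_nth_drop_Suc[symmetric])
  ultimately show ?thesis by simp
qed

text \<open>Half and parity are updated together: the half grows when the counter passes from odd to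
  even. Both are needed because \<open>int_encode\<close> stores the sign in the parity.\<close>

lemma computable_parity:
  assumes "computable f"
  shows "computable (\<lambda>e. f e div 2)" "computable (\<lambda>e. odd (f e :: nat))"
proof -
  let ?r = "rec_nat (0, False) (\<lambda>_ r. (if snd r then Suc (fst r) else fst r, \<not> snd r))"
  have r: "?r n = (n div 2, odd n)" for n
    by (induction n) auto
  have "computable (\<lambda>e. fst (?r (f e)))" "computable (\<lambda>e. snd (?r (f e)))"
    by (intro computable_intros assms)+
  then show "computable (\<lambda>e. f e div 2)" "computable (\<lambda>e. odd (f e))"
    by (simp_all add: r)
qed


section \<open>Fractions\<close>

text \<open>The triple \<open>(p, m, d)\<close> stands for \<open>(p - m) / (d + 1)\<close>, so that every triple is a valid fraction.\<close>

type_synonym frac = "nat \<times> nat \<times> nat"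

definition frac_val :: "frac \<Rightarrow> rat" where
  "frac_val c = (of_nat (fst c) - of_nat (fst (snd c))) / of_nat (Suc (snd (snd c)))"

definition frac_of_rat :: "rat \<Rightarrow> frac" where
  "frac_of_rat q =
     (nat (fst (quotient_of q)), nat (- fst (quotient_of q)), nat (snd (quotient_of q)) - 1)"

text \<open>The third component is a denominator minus 1, whence the successors and the final
  \<open>- 1\<close>. Fractions are never reduced.\<close>

definition frac_add :: "frac \<Rightarrow> frac \<Rightarrow> frac" where
  "frac_add b c =
     (fst b * Suc (snd (snd c)) + fst c * Suc (snd (snd b)),
      fst (snd b) * Suc (snd (snd c)) + fst (snd c) * Suc (snd (snd b)),
      Suc (snd (snd b)) * Suc (snd (snd c)) - 1)"

definition frac_mult :: "frac \<Rightarrow> frac \<Rightarrow> frac" where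
  "frac_mult b c =
     (fst b * fst c + fst (snd b) * fst (snd c), fst b * fst (snd c) + fst (snd b) * fst c,
      Suc (snd (snd b)) * Suc (snd (snd c)) - 1)"

definition frac_uminus :: "frac \<Rightarrow> frac" where
  "frac_uminus c = (fst (snd c), fst c, snd (snd c))"

definition frac_is_zero :: "frac \<Rightarrow> bool" where
  "frac_is_zero c \<longleftrightarrow> fst c = fst (snd c)"

lemma frac_val_of_rat [simp]: "frac_val (frac_of_rat q) = q"
proof -
  obtain a b where ab: "quotient_of q = (a, b)" by force
  have b: "b > 0" using quotient_of_denom_pos[OF ab] .
  have "rat_of_nat (nat a) - rat_of_nat (nat (- a)) = of_int a"
    by (cases "a \<ge> 0") simp_all
  moreover have "Suc (nat b - 1) = nat b"
    using b by simp
  moreover have "rat_of_nat (nat b) = of_int b"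
    using b by simp
  ultimately show ?thesis
    unfolding frac_val_def frac_of_rat_def ab fst_conv snd_conv
    using quotient_of_div[OF ab] by metis
qed

lemma frac_val_common:
  "frac_val (p, m, Suc d * Suc e - 1) =
     (of_nat p - of_nat m) / (of_nat (Suc d) * of_nat (Suc e))"
  unfolding frac_val_def fst_conv snd_conv of_nat_mult[symmetric] by simp

lemma frac_val_add [simp]: "frac_val (frac_add b c) = frac_val b + frac_val c"
proof -
  obtain p m d q n e where b: "b = (p, m, d)" and c: "c = (q, n, e)"
    by (metis prod_cases3)
  define D E where "D = rat_of_nat (Suc d)" "E = rat_of_nat (Suc e)"
  then have "D \<noteq> 0" "E \<noteq> 0" by (simp_all add: of_nat_neq_0 del: of_nat_Suc)
  then show ?thesis
    unfolding b c frac_add_def fst_conv snd_conv frac_val_common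
    unfolding frac_val_def fst_conv snd_conv of_nat_add of_nat_mult D_E_def[symmetric]
    by (simp add: field_simps)
qed

lemma frac_val_mult [simp]: "frac_val (frac_mult b c) = frac_val b * frac_val c"
  unfolding frac_mult_def frac_val_common
  unfolding frac_val_def of_nat_add of_nat_mult times_divide_times_eq
  by (rule arg_cong[where f = "\<lambda>x. x / _"]) (simp add: algebra_simps)

lemma frac_val_uminus [simp]: "frac_val (frac_uminus c) = - frac_val c"
  by (simp add: frac_val_def frac_uminus_def minus_divide_left del: of_nat_Suc)

lemma frac_is_zero_iff: "frac_is_zero c \<longleftrightarrow> frac_val c = 0"
  by (simp add: frac_is_zero_def frac_val_def del: of_nat_Suc)

lemma computable_frac_of_rat [computable_intros]:
  assumes "computable f"
  shows "computable (\<lambda>e. frac_of_rat (f e))"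
proof -
  \<comment> \<open>\<open>int_encode\<close> sends \<open>i \<ge> 0\<close> to \<open>2 * i\<close>
    and \<open>i < 0\<close> to \<open>2 * (- i - 1) + 1\<close>; the positive denominator is
    therefore \<open>v div 2\<close>.\<close>
  define dec where "dec z = (let u = fst (prod_decode z); v = snd (prod_decode z) in
      ((if odd u then 0 else u div 2, if odd u then Suc (u div 2) else 0, v div 2 - 1) :: frac))" for z
  have "computable (\<lambda>e. dec (encode (f e)))"
    unfolding dec_def Let_def
    by (intro computable_intros computable_parity computable_prod_decode assms)
  moreover have "dec (encode q) = frac_of_rat q" for q
  proof -
    obtain a b where ab: "quotient_of q = (a, b)" by force
    have b: "b > 0" using quotient_of_denom_pos[OF ab] .
    have *: "Suc (nat (- a - 1)) = nat (- a)" if "a < 0" using that by simp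
    show ?thesis
      using b by (auto simp: dec_def Let_def encode_rat_def rat_code_def frac_of_rat_def ab
          int_encode_def sum_encode_def *)
  qed
  ultimately show ?thesis by simp
qed

lemma computable_frac [computable_intros]:
  assumes "computable f"
  shows "computable g \<Longrightarrow> computable (\<lambda>e. frac_add (f e) (g e))"
    "computable g \<Longrightarrow> computable (\<lambda>e. frac_mult (f e) (g e))"
    "computable (\<lambda>e. frac_uminus (f e))" "computable (\<lambda>e. frac_is_zero (f e))"
  unfolding frac_add_def frac_mult_def frac_uminus_def frac_is_zero_def
  by (intro computable_intros assms; assumption)+


section \<open>Hilbert's basis theorem for subrings\<close>

text \<open>Rings are subsets of a type, so that their number of variables can be a value.\<close>

definition subring :: "'a::comm_ring_1 set \<Rightarrow> bool" where
  "subring S \<longleftrightarrow> 1 \<in> S \<and> (\<forall>x\<in>S. \<forall>y\<in>S. x - y \<in> S \<and> x * y \<in> S)"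

text \<open>For a subring \<open>S\<close> containing \<open>G\<close> this is the ideal generated
  by \<open>G\<close>.\<close>

inductive_set combinations :: "'a::comm_ring_1 set \<Rightarrow> 'a set \<Rightarrow> 'a set" for S G where
  zero: "0 \<in> combinations S G"
| add: "x \<in> combinations S G \<Longrightarrow> s \<in> S \<Longrightarrow> g \<in> G \<Longrightarrow> x + s * g \<in> combinations S G"

text \<open>The generators come from \<open>G\<close> itself and not merely from its ideal; this is
  what makes the generators used in certificates word polynomials.\<close>

definition noetherian :: "'a::comm_ring_1 set \<Rightarrow> bool" where
  "noetherian S \<longleftrightarrow> (\<forall>G\<subseteq>S. \<exists>G0\<subseteq>G. finite G0 \<and> G \<subseteq> combinations S G0)"

lemma subringD:
  assumes "subring S"
  shows "1 \<in> S" "x \<in> S \<Longrightarrow> y \<in> S \<Longrightarrow> x - y \<in> S" "x \<in> S \<Longrightarrow> y \<in> S \<Longrightarrow> x * y \<in> S"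
    "0 \<in> S" "x \<in> S \<Longrightarrow> - x \<in> S" "x \<in> S \<Longrightarrow> y \<in> S \<Longrightarrow> x + y \<in> S"
proof -
  have diff: "x - y \<in> S" if "x \<in> S" "y \<in> S" for x y
    using assms that by (auto simp: subring_def)
  show "1 \<in> S" "x \<in> S \<Longrightarrow> y \<in> S \<Longrightarrow> x - y \<in> S" "x \<in> S \<Longrightarrow> y \<in> S \<Longrightarrow> x * y \<in> S"
    using assms by (auto simp: subring_def)
  then show 0: "0 \<in> S" using diff[of 1 1] by simp
  have uminus: "- x \<in> S" if "x \<in> S" for x
    using diff[OF 0 that] by simp
  then show "x \<in> S \<Longrightarrow> - x \<in> S" .
  show "x + y \<in> S" if "x \<in> S" "y \<in> S"
    using diff[OF that(1) uminus[OF that(2)]] by simp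
qed

lemma combinations_base: "subring S \<Longrightarrow> g \<in> G \<Longrightarrow> g \<in> combinations S G"
  using combinations.add[OF combinations.zero, of 1 S g G] by (simp add: subringD)

lemma combinations_add:
  "x \<in> combinations S G \<Longrightarrow> y \<in> combinations S G \<Longrightarrow> x + y \<in> combinations S G"
  by (rotate_tac 1, induction y rule: combinations.induct) (auto simp: add.assoc[symmetric] intro: combinations.add)

lemma combinations_mult:
  assumes "subring S" "s \<in> S" "x \<in> combinations S G"
  shows "s * x \<in> combinations S G"
  using assms(3)
  by induction (auto simp: distrib_left mult.assoc[symmetric]
      intro!: combinations.intros subringD(3)[OF assms(1)] assms(2))

lemma combinations_subset:
  assumes "subring S" "G \<subseteq> combinations S H"
  shows "combinations S G \<subseteq> combinations S H"
proof
  fix x assume "x \<in> combinations S G"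
  then show "x \<in> combinations S H"
    using assms by induction (auto intro!: combinations.zero combinations_add combinations_mult)
qed

lemma combinations_mono: "G \<subseteq> H \<Longrightarrow> x \<in> combinations S G \<Longrightarrow> x \<in> combinations S H"
  by (rotate_tac 1, induction x rule: combinations.induct) (auto intro: combinations.intros)

lemma combinations_finite:
  assumes "x \<in> combinations S G"
  shows "\<exists>G0\<subseteq>G. finite G0 \<and> x \<in> combinations S G0"
  using assms
proof induction
  case zero
  show ?case by (rule exI[of _ "{}"]) (auto intro: combinations.zero)
next
  case (add x s g)
  then obtain G0 where "G0 \<subseteq> G" "finite G0" "x \<in> combinations S G0" by blast
  then show ?case using add
    by (intro exI[of _ "insert g G0"])
      (auto intro!: combinations.add intro: combinations_mono[of G0 "insert g G0"])
qed

lemma combinations_finite_set: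
  assumes "finite X" "X \<subseteq> combinations S G"
  shows "\<exists>G0\<subseteq>G. finite G0 \<and> X \<subseteq> combinations S G0"
  using assms
proof induction
  case empty
  show ?case by (rule exI[of _ "{}"]) auto
next
  case (insert x X)
  then obtain G0 where 0: "G0 \<subseteq> G" "finite G0" "X \<subseteq> combinations S G0" by auto
  obtain G1 where 1: "G1 \<subseteq> G" "finite G1" "x \<in> combinations S G1"
    using combinations_finite[of x S G] insert.prems by auto
  have "insert x X \<subseteq> combinations S (G0 \<union> G1)"
    using 0 1 by (auto intro: combinations_mono[of G0 "G0 \<union> G1"] combinations_mono[of G1 "G0 \<union> G1"])
  then show ?case using 0 1 by (intro exI[of _ "G0 \<union> G1"]) auto
qed

section \<open>Polynomials over a subring and the minimal-degree argument\<close>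

definition polys_over :: "'a::comm_ring_1 set \<Rightarrow> 'a poly set" where
  "polys_over S = {p. \<forall>i. coeff p i \<in> S}"

lemma subring_sum: "subring S \<Longrightarrow> (\<And>i. i \<in> A \<Longrightarrow> f i \<in> S) \<Longrightarrow> sum f A \<in> S"
  by (induction A rule: infinite_finite_induct) (auto simp: subringD)

lemma subring_polys_over: "subring S \<Longrightarrow> subring (polys_over S)"
  unfolding subring_def[of "polys_over S"]
  by (auto simp: polys_over_def coeff_mult subringD intro!: subring_sum split: if_splits)

text \<open>Multiplying \<open>g i\<close> by \<open>s X^(d - degree (g i))\<close> moves its
  leading coefficient to degree \<open>d\<close>, so combinations of leading coefficients lift to
  polynomials.\<close>

lemma combinations_leading_coeff:
  assumes S: "subring S" and c: "c \<in> combinations S ((\<lambda>i. lead_coeff (g i)) ` I)"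
    and d: "\<And>i. i \<in> I \<Longrightarrow> degree (g i) \<le> d"
  shows "\<exists>q\<in>combinations (polys_over S) (g ` I). degree q \<le> d \<and> coeff q d = c"
  using c
proof induction
  case zero
  show ?case by (rule bexI[of _ 0]) (auto intro: combinations.zero)
next
  case (add x s a)
  then obtain q i where q: "q \<in> combinations (polys_over S) (g ` I)" "degree q \<le> d" "coeff q d = x"
    and i: "i \<in> I" "a = lead_coeff (g i)" by blast
  let ?m = "monom s (d - degree (g i))"
  have "degree (?m * g i) \<le> d"
    using degree_mult_le[of ?m "g i"] degree_monom_le[of s "d - degree (g i)"] d[OF i(1)] by linarith
  moreover have "coeff (?m * g i) d = s * a"
    using d[OF i(1)] i(2) by (simp add: coeff_monom_mult)
  moreover have "?m \<in> polys_over S"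
    using add.hyps(2) subringD(4)[OF S] by (auto simp: polys_over_def)
  ultimately show ?case using q i
    by (intro bexI[of _ "q + ?m * g i"]) (auto intro: combinations.add degree_add_le)
qed

theorem noetherian_polys_over:
  assumes S: "subring S" and N: "noetherian S"
  shows "noetherian (polys_over S)"
  unfolding noetherian_def
proof (intro allI impI)
  fix G assume G: "G \<subseteq> polys_over S"
  let ?C = "combinations (polys_over S)"
  note R = subring_polys_over[OF S]
  have CS: "?C G \<subseteq> polys_over S"
  proof
    fix x assume "x \<in> ?C G"
    then show "x \<in> polys_over S"
      by induction (use G in \<open>auto intro!: subringD[OF R]\<close>)
  qed
  show "\<exists>G0\<subseteq>G. finite G0 \<and> G \<subseteq> ?C G0"
  proof (rule ccontr)
    assume contra: "\<not> ?thesis"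
    \<comment> \<open>A finite \<open>X\<close> generating the whole ideal involves only finitely
      many elements of \<open>G\<close>, and these would generate \<open>G\<close>, against
      \<open>contra\<close>.\<close>
    have ex: "\<exists>p. p \<in> ?C G - ?C X" if X: "finite X" "X \<subseteq> ?C G" for X
    proof (rule ccontr)
      assume "\<nexists>p. p \<in> ?C G - ?C X"
      then have sub: "?C G \<subseteq> ?C X" by blast
      obtain G0 where G0: "G0 \<subseteq> G" "finite G0" "X \<subseteq> ?C G0"
        using combinations_finite_set[OF X] by blast
      have "G \<subseteq> ?C G0"
        using combinations_base[OF R] sub combinations_subset[OF R G0(3)] by blast
      then show False using contra G0 by blast
    qed
    define next_poly where
      "next_poly X = (ARG_MIN degree p. p \<in> ?C G - ?C X)" for X
    have next_poly: "next_poly X \<in> ?C G - ?C X"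
      "\<And>p. p \<in> ?C G - ?C X \<Longrightarrow> degree (next_poly X) \<le> degree p"
      if X: "finite X" "X \<subseteq> ?C G" for X
    proof -
      obtain p where "p \<in> ?C G - ?C X" using ex[OF X] by blast
      from arg_min_nat_lemma[of "\<lambda>p. p \<in> ?C G - ?C X", OF this]
      show "next_poly X \<in> ?C G - ?C X"
        "\<And>p. p \<in> ?C G - ?C X \<Longrightarrow> degree (next_poly X) \<le> degree p"
        unfolding next_poly_def by blast+
    qed
    define X where "X = rec_nat {} (\<lambda>_ X. insert (next_poly X) X)"
    define g where "g k = next_poly (X k)" for k
    have X_0: "X 0 = {}" and X_Suc: "X (Suc k) = insert (g k) (X k)" for k
      by (simp_all add: X_def g_def)
    have X: "finite (X k) \<and> X k \<subseteq> ?C G" for k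
      by (induction k) (use next_poly in \<open>auto simp: X_0 X_Suc g_def\<close>)
    have X_eq: "X k = g ` {..<k}" for k
      by (induction k) (auto simp: X_0 X_Suc lessThan_Suc)
    have g: "g k \<in> ?C G - ?C (g ` {..<k})" for k
      unfolding X_eq[symmetric] g_def using next_poly(1) X by blast
    have g_min: "degree (g k) \<le> degree p" if "p \<in> ?C G - ?C (g ` {..<k})" for k p
      using that unfolding X_eq[symmetric] g_def using next_poly(2) X by blast
    \<comment> \<open>The excluded ideals grow, so \<open>g k\<close> was already a candidate when
      \<open>g i\<close> was chosen with least degree.\<close>
    have deg: "degree (g i) \<le> degree (g k)" if "i < k" for i k
    proof (rule g_min)
      show "g k \<in> ?C G - ?C (g ` {..<i})"
        using g[of k] combinations_mono[of "g ` {..<i}" "g ` {..<k}" "g k"] that by fastforce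
    qed
    have "range (\<lambda>i. lead_coeff (g i)) \<subseteq> S"
      using g CS by (fastforce simp: polys_over_def)
    then obtain A where A: "A \<subseteq> range (\<lambda>i. lead_coeff (g i))" "finite A"
      "range (\<lambda>i. lead_coeff (g i)) \<subseteq> combinations S A"
      using N unfolding noetherian_def by meson
    then obtain J where J: "finite J" "A = (\<lambda>i. lead_coeff (g i)) ` J"
      by (meson finite_subset_image)
    \<comment> \<open>The generating leading coefficients have indices below \<open>k\<close>, so
      that of \<open>g k\<close> is a combination of earlier ones.\<close>
    obtain k where k: "J \<subseteq> {..<k}"
      using J(1) finite_nat_iff_bounded by blast
    have "lead_coeff (g k) \<in> combinations S ((\<lambda>i. lead_coeff (g i)) ` {..<k})"
      using A(3) J(2) k by (blast intro: combinations_mono[rotated])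
    then obtain q where q: "q \<in> ?C (g ` {..<k})" "degree q \<le> degree (g k)"
      "coeff q (degree (g k)) = lead_coeff (g k)"
      using combinations_leading_coeff[OF S, of "lead_coeff (g k)" g "{..<k}" "degree (g k)"] deg
      by auto
    \<comment> \<open>\<open>q\<close> cancels the leading term of \<open>g k\<close> and lies in
      the ideal of the earlier polynomials. The difference stays outside that ideal but is 0 or of
      smaller degree; both are impossible.\<close>
    let ?r = "g k - q"
    have neg: "- q \<in> ?C (g ` {..<k})"
      using combinations_mult[OF R subringD(5)[OF R subringD(1)[OF R]] q(1)] by simp
    have "g ` {..<k} \<subseteq> ?C G" using g by blast
    then have "?r \<in> ?C G"
      using g[of k] neg combinations_subset[OF R, of "g ` {..<k}" G] combinations_add[of "g k" _ G "- q"]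
      by auto
    moreover have "?r \<notin> ?C (g ` {..<k})"
      using g[of k] q(1) combinations_add[of ?r _ "g ` {..<k}" q] by auto
    ultimately have min: "degree (g k) \<le> degree ?r" by (auto intro: g_min)
    have "degree ?r \<le> degree (g k)" "coeff ?r (degree (g k)) = 0"
      using q by (auto intro: degree_diff_le)
    then have "?r = 0"
      using eq_zero_or_degree_less min by (metis linorder_not_less)
    then show False using \<open>?r \<notin> _\<close> by (simp add: combinations.zero)
  qed
qed

text \<open>Lift \<open>G\<close> to a subset of \<open>S\<close>; the images of finitely many
  generators of the lift generate \<open>G\<close>.\<close>

lemma noetherian_image:
  assumes N: "noetherian S" and \<phi>: "\<phi> 0 = 0" "\<And>x y. \<phi> (x + y) = \<phi> x + \<phi> y"
    "\<And>x y. \<phi> (x * y) = \<phi> x * \<phi> y"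
  shows "noetherian (\<phi> ` S)"
  unfolding noetherian_def
proof (intro allI impI)
  fix G assume "G \<subseteq> \<phi> ` S"
  then obtain H where H: "H \<subseteq> S" "G = \<phi> ` H" by (meson subset_imageE)
  then obtain H0 where H0: "H0 \<subseteq> H" "finite H0" "H \<subseteq> combinations S H0"
    using N unfolding noetherian_def by meson
  have "\<phi> x \<in> combinations (\<phi> ` S) (\<phi> ` H0)" if "x \<in> combinations S H0" for x
    using that by induction (auto simp: \<phi> intro!: combinations.intros)
  then show "\<exists>G0\<subseteq>G. finite G0 \<and> G \<subseteq> combinations (\<phi> ` S) G0"
    using H H0 by (intro exI[of _ "\<phi> ` H0"]) auto
qed

text \<open>The ring \<open>S[x]\<close>, as the image of polynomials under evaluation, whether or
  not \<open>x\<close> satisfies a relation over \<open>S\<close>.\<close>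

definition adjoin :: "'a::comm_ring_1 set \<Rightarrow> 'a \<Rightarrow> 'a set" where
  "adjoin S x = (\<lambda>p. poly p x) ` polys_over S"

lemma noetherian_adjoin: "subring S \<Longrightarrow> noetherian S \<Longrightarrow> noetherian (adjoin S x)"
  unfolding adjoin_def by (intro noetherian_image noetherian_polys_over) simp_all

lemma subring_adjoin:
  assumes "subring S"
  shows "subring (adjoin S x)"
  unfolding subring_def
proof (intro conjI ballI)
  note R = subring_polys_over[OF assms]
  show "1 \<in> adjoin S x"
    using subringD(1)[OF R] by (auto simp: adjoin_def intro!: image_eqI[of _ _ 1])
  fix y z assume "y \<in> adjoin S x" "z \<in> adjoin S x"
  then obtain p q where "p \<in> polys_over S" "q \<in> polys_over S" "y = poly p x" "z = poly q x"
    by (auto simp: adjoin_def)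
  then have "y - z = poly (p - q) x" "p - q \<in> polys_over S"
    "y * z = poly (p * q) x" "p * q \<in> polys_over S"
    using subringD(2,3)[OF R] by auto
  then show "y - z \<in> adjoin S x" "y * z \<in> adjoin S x"
    unfolding adjoin_def by blast+
qed

lemma adjoin_superset: "subring S \<Longrightarrow> s \<in> S \<Longrightarrow> s \<in> adjoin S x"
  unfolding adjoin_def
  by (rule image_eqI[of _ _ "[:s:]"]) (auto simp: polys_over_def coeff_pCons subringD split: nat.split)

lemma adjoin_generator: "subring S \<Longrightarrow> x \<in> adjoin S x"
  unfolding adjoin_def
  by (rule image_eqI[of _ _ "[:0, 1:]"]) (auto simp: polys_over_def coeff_pCons subringD split: nat.split)


section \<open>Polynomial functions\<close>

type_synonym point_fun = "(nat \<Rightarrow> rat) \<Rightarrow> rat"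

text \<open>Polynomial functions of the first \<open>n\<close> coordinates with pointwise
  operations, all inside one ring for every \<open>n\<close>.\<close>

primrec poly_funs :: "nat \<Rightarrow> point_fun set" where
  "poly_funs 0 = range (\<lambda>c _. c)"
| "poly_funs (Suc n) = adjoin (poly_funs n) (\<lambda>y. y n)"

lemma subring_poly_funs: "subring (poly_funs n)"
proof (induction n)
  case 0
  show ?case by (auto simp: subring_def one_fun_def fun_diff_def times_fun_def)
next
  case (Suc n)
  then show ?case by (simp add: subring_adjoin)
qed

lemma noetherian_poly_funs: "noetherian (poly_funs n)"
proof (induction n)
  case 0
  show ?case
    unfolding noetherian_def
  proof (intro allI impI)
    fix G :: "point_fun set" assume G: "G \<subseteq> poly_funs 0"
    show "\<exists>G0\<subseteq>G. finite G0 \<and> G \<subseteq> combinations (poly_funs 0) G0"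
    proof (cases "\<exists>g\<in>G. g \<noteq> 0")
      case False
      then show ?thesis by (intro exI[of _ "{}"]) (auto intro: combinations.zero)
    next
      case True
      then obtain c where c: "(\<lambda>_. c) \<in> G" "c \<noteq> 0"
        using G by (auto simp: zero_fun_def)
      \<comment> \<open>The constants form a field, so one nonzero constant generates
        everything.\<close>
      have "f \<in> combinations (poly_funs 0) {\<lambda>_. c}" if f: "f \<in> G" for f
      proof -
        obtain d where "f = (\<lambda>_. d)" using G f by auto
        then have "f = 0 + (\<lambda>_. d / c) * (\<lambda>_. c)" using c by (auto simp: fun_eq_iff)
        then show ?thesis
          by (metis combinations.add combinations.zero poly_funs.simps(1) rangeI singletonI)
      qed
      then show ?thesis using c by (intro exI[of _ "{\<lambda>_. c}"]) auto
    qed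
  qed
next
  case (Suc n)
  then show ?case by (simp add: noetherian_adjoin subring_poly_funs)
qed

lemma const_in_poly_funs: "(\<lambda>_. c) \<in> poly_funs n"
  by (induction n) (auto intro: adjoin_superset subring_poly_funs)

lemma proj_in_poly_funs: "i < n \<Longrightarrow> (\<lambda>y. y i) \<in> poly_funs n"
  by (induction n) (auto simp: less_Suc_eq intro: adjoin_superset adjoin_generator subring_poly_funs)


section \<open>Polynomials as lists of terms\<close>

text \<open>
  Exponent lists may have any length, missing exponents being 0. Points are given by the
  values of all variables, so that no arity has to be tracked.
\<close>

type_synonym list_poly = "(nat list \<times> frac) list"

definition mono_val :: "nat list \<Rightarrow> (nat \<Rightarrow> rat) \<Rightarrow> rat" where
  "mono_val es y = (\<Prod>i<length es. y i ^ (es ! i))"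

definition lp_val :: "list_poly \<Rightarrow> (nat \<Rightarrow> rat) \<Rightarrow> rat" where
  "lp_val p y = (\<Sum>t\<leftarrow>p. frac_val (snd t) * mono_val (fst t) y)"

text \<open>The sum of the lengths is merely a convenient bound for both; surplus exponents are
  0.\<close>

definition mono_mult :: "nat list \<Rightarrow> nat list \<Rightarrow> nat list" where
  "mono_mult es fs = map (\<lambda>i. nth_default 0 es i + nth_default 0 fs i) [0..<length es + length fs]"

definition mono_eq :: "nat list \<Rightarrow> nat list \<Rightarrow> bool" where
  "mono_eq es fs \<longleftrightarrow>
     list_all (\<lambda>i. nth_default 0 es i = nth_default 0 fs i) [0..<length es + length fs]"

definition lp_const :: "frac \<Rightarrow> list_poly" where
  "lp_const c = [([], c)]"

definition lp_one :: list_poly where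
  "lp_one = lp_const (1, 0, 0)"

definition lp_uminus :: "list_poly \<Rightarrow> list_poly" where
  "lp_uminus p = map (\<lambda>t. (fst t, frac_uminus (snd t))) p"

definition lp_mult :: "list_poly \<Rightarrow> list_poly \<Rightarrow> list_poly" where
  "lp_mult p q =
     concat (map (\<lambda>s. map (\<lambda>t. (mono_mult (fst s) (fst t), frac_mult (snd s) (snd t))) q) p)"

definition lp_power :: "list_poly \<Rightarrow> nat \<Rightarrow> list_poly" where
  "lp_power p k = rec_nat lp_one (\<lambda>_ r. lp_mult p r) k"

text \<open>Variables beyond the length of \<open>Q\<close> are replaced by \<open>[]\<close>, the
  zero polynomial.\<close>

definition lp_subst :: "list_poly \<Rightarrow> list_poly list \<Rightarrow> list_poly" where
  "lp_subst p Q = concat (map (\<lambda>t. lp_mult (lp_const (snd t))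
     (foldr (\<lambda>i r. lp_mult (lp_power (nth_default [] Q i) (nth_default 0 (fst t) i)) r)
       [0..<length (fst t)] lp_one)) p)"

text \<open>A monomial may be listed repeatedly, also with extra trailing zeros; all its
  coefficients are added before the test.\<close>

definition lp_is_zero :: "list_poly \<Rightarrow> bool" where
  "lp_is_zero p \<longleftrightarrow> list_all (\<lambda>s. frac_is_zero
     (foldr (\<lambda>t c. if mono_eq (fst s) (fst t) then frac_add (snd t) c else c) p (0, 0, 0))) p"

lemma mono_val_bound:
  assumes "length es \<le> n"
  shows "mono_val es y = (\<Prod>i<n. y i ^ nth_default 0 es i)"
proof -
  have "(\<Prod>i<n. y i ^ nth_default 0 es i) = (\<Prod>i<length es. y i ^ nth_default 0 es i)"
    using assms by (intro prod.mono_neutral_right) (auto simp: nth_default_def)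
  also have "\<dots> = mono_val es y"
    unfolding mono_val_def by (intro prod.cong) (auto simp: nth_default_def)
  finally show ?thesis ..
qed

lemma mono_val_mult: "mono_val (mono_mult es fs) y = mono_val es y * mono_val fs y"
proof -
  let ?n = "length es + length fs"
  have "nth_default 0 (mono_mult es fs) i = nth_default 0 es i + nth_default 0 fs i" if "i < ?n" for i
    using that by (simp add: mono_mult_def nth_default_def)
  then show ?thesis
    by (simp add: mono_val_bound[of _ ?n] mono_mult_def power_add flip: prod.distrib)
qed

lemma mono_eq_iff: "mono_eq es fs \<longleftrightarrow> nth_default 0 es = nth_default 0 fs"
proof -
  have "nth_default 0 es i = nth_default 0 fs i" if "\<not> i < length es + length fs" for i
    using that by (simp add: nth_default_def)
  then show ?thesis by (auto simp: mono_eq_def list_all_iff fun_eq_iff)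
qed

lemma lp_val_Nil [simp]: "lp_val [] y = 0"
  by (simp add: lp_val_def)

lemma lp_val_append [simp]: "lp_val (p @ q) y = lp_val p y + lp_val q y"
  by (simp add: lp_val_def)

lemma lp_val_concat: "lp_val (concat ps) y = (\<Sum>p\<leftarrow>ps. lp_val p y)"
  by (induction ps) auto

lemma lp_val_const [simp]: "lp_val (lp_const c) y = frac_val c"
  by (simp add: lp_val_def lp_const_def mono_val_def)

lemma lp_val_one [simp]: "lp_val lp_one y = 1"
  by (simp add: lp_one_def frac_val_def)

lemma lp_val_uminus [simp]: "lp_val (lp_uminus p) y = - lp_val p y"
  by (induction p) (simp_all add: lp_val_def lp_uminus_def)

lemma lp_val_mult [simp]: "lp_val (lp_mult p q) y = lp_val p y * lp_val q y"
proof -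
  have "lp_val (map (\<lambda>t. (mono_mult (fst s) (fst t), frac_mult (snd s) (snd t))) q) y =
      frac_val (snd s) * mono_val (fst s) y * lp_val q y" for s
    by (induction q) (simp_all add: lp_val_def mono_val_mult algebra_simps)
  then show ?thesis
    by (simp add: lp_mult_def lp_val_concat o_def sum_list_mult_const lp_val_def[of p])
qed

lemma lp_val_power [simp]: "lp_val (lp_power p k) y = lp_val p y ^ k"
  unfolding lp_power_def by (induction k) simp_all

lemma lp_val_subst: "lp_val (lp_subst p Q) y = lp_val p (\<lambda>i. lp_val (nth_default [] Q i) y)"
proof -
  have *: "lp_val (foldr (\<lambda>i r. lp_mult (f i) r) xs lp_one) y = (\<Prod>i\<leftarrow>xs. lp_val (f i) y)" for f xs
    by (induction xs) simp_all
  show ?thesis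
    by (simp add: lp_subst_def lp_val_concat o_def * prod.list_conv_set_nth interv_sum_list_conv_sum_set_nat
        lp_val_def[of p] mono_val_bound[OF order_refl] lessThan_atLeast0)
qed

section \<open>Correctness of the zero test\<close>

definition mono_coeff :: "list_poly \<Rightarrow> (nat \<Rightarrow> nat) \<Rightarrow> rat" where
  "mono_coeff p E = (\<Sum>t\<leftarrow>p. if nth_default 0 (fst t) = E then frac_val (snd t) else 0)"

lemma lp_is_zero_iff:
  "lp_is_zero p \<longleftrightarrow> (\<forall>E\<in>(\<lambda>t. nth_default 0 (fst t)) ` set p. mono_coeff p E = 0)"
proof -
  have "frac_val (foldr (\<lambda>t c. if mono_eq es (fst t) then frac_add (snd t) c else c) q (0, 0, 0)) =
      mono_coeff q (nth_default 0 es)" for es q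
    by (induction q) (auto simp: mono_coeff_def mono_eq_iff frac_val_def[of "(0, 0, 0)"])
  then show ?thesis
    by (simp add: lp_is_zero_def frac_is_zero_iff list_all_iff)
qed

lemma lp_val_eq_sum_mono_coeff:
  assumes "finite A" "(\<lambda>t. nth_default 0 (fst t)) ` set p \<subseteq> A" "\<forall>t\<in>set p. length (fst t) \<le> n"
  shows "lp_val p y = (\<Sum>E\<in>A. mono_coeff p E * (\<Prod>i<n. y i ^ E i))"
  using assms(2,3)
proof (induction p)
  case Nil
  show ?case by (simp add: mono_coeff_def)
next
  case (Cons t p)
  let ?E = "nth_default 0 (fst t)"
  have "(\<Sum>E\<in>A. mono_coeff (t # p) E * (\<Prod>i<n. y i ^ E i)) =
      (\<Sum>E\<in>A. (if ?E = E then frac_val (snd t) * (\<Prod>i<n. y i ^ E i) else 0) +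
        mono_coeff p E * (\<Prod>i<n. y i ^ E i))"
    by (intro sum.cong) (auto simp: mono_coeff_def algebra_simps)
  also have "\<dots> = frac_val (snd t) * (\<Prod>i<n. y i ^ ?E i) + lp_val p y"
    using Cons assms(1) by (simp add: sum.distrib)
  also have "\<dots> = lp_val (t # p) y"
    using Cons.prems by (simp add: lp_val_def mono_val_bound[of _ n])
  finally show ?case ..
qed

text \<open>
  Fixing the exponents from \<open>n\<close> on lets the induction on \<open>n\<close> split \<open>A\<close> by the exponent of the
  last variable, with respect to which the sum is a univariate polynomial.
\<close>

lemma monomials_independent:
  fixes c :: "(nat \<Rightarrow> nat) \<Rightarrow> rat"
  assumes "finite A" "\<forall>E\<in>A. \<forall>i\<ge>n. E i = u i" "\<forall>y. (\<Sum>E\<in>A. c E * (\<Prod>i<n. y i ^ E i)) = 0"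
    "E \<in> A"
  shows "c E = 0"
  using assms
proof (induction n arbitrary: A u)
  case 0
  then have "A = {E}" by (auto simp: fun_eq_iff) metis
  then show ?case using "0.prems"(3) by simp
next
  case (Suc n)
  let ?B = "{E' \<in> A. E' n = E n}"
  show ?case
  proof (rule Suc.IH[of ?B "u(n := E n)"])
    show "finite ?B" "E \<in> ?B" using Suc.prems by auto
    show "\<forall>E'\<in>?B. \<forall>i\<ge>n. E' i = (u(n := E n)) i"
      using Suc.prems(2) by (auto simp: Suc_le_eq)
    show "\<forall>y. (\<Sum>E\<in>?B. c E * (\<Prod>i<n. y i ^ E i)) = 0"
    proof
      fix y :: "nat \<Rightarrow> rat"
      let ?p = "\<Sum>E\<in>A. monom (c E * (\<Prod>i<n. y i ^ E i)) (E n)"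
      have "poly ?p x = 0" for x
      proof -
        have "poly ?p x = (\<Sum>E\<in>A. c E * (\<Prod>i<Suc n. (y(n := x)) i ^ E i))"
          by (simp add: poly_sum poly_monom mult.assoc)
        also have "\<dots> = 0" using Suc.prems(3) by blast
        finally show ?thesis .
      qed
      then have "?p = 0" using poly_all_0_iff_0[of ?p] by blast
      then have "coeff ?p (E n) = 0" by (simp only: coeff_0)
      also have "coeff ?p (E n) = (\<Sum>E'\<in>A. if E' n = E n then c E' * (\<Prod>i<n. y i ^ E' i) else 0)"
        by (auto simp: coeff_sum intro!: sum.cong)
      also have "\<dots> = (\<Sum>E\<in>?B. c E * (\<Prod>i<n. y i ^ E i))"
        using Suc.prems(1) by (simp add: sum.inter_filter)
      finally show "(\<Sum>E\<in>?B. c E * (\<Prod>i<n. y i ^ E i)) = 0" .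
    qed
  qed
qed

text \<open>Regrouping by monomials gives one direction, independence of the monomial functions the
  other. This links what a program can check to identities of functions.\<close>

lemma lp_is_zero_iff_val: "lp_is_zero p \<longleftrightarrow> (\<forall>y. lp_val p y = 0)"
proof -
  let ?A = "(\<lambda>t. nth_default 0 (fst t)) ` set p" and ?n = "Max (insert 0 (length ` fst ` set p))"
  have n: "\<forall>t\<in>set p. length (fst t) \<le> ?n" by (auto intro: Max_ge)
  note val = lp_val_eq_sum_mono_coeff[OF _ order_refl n, simplified]
  show ?thesis
  proof
    assume "lp_is_zero p"
    then have "mono_coeff p E = 0" if "E \<in> ?A" for E
      using that by (auto simp: lp_is_zero_iff)
    then show "\<forall>y. lp_val p y = 0" unfolding val by (simp cong: sum.cong)
  next
    assume "\<forall>y. lp_val p y = 0"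
    then have "\<forall>y. (\<Sum>E\<in>?A. mono_coeff p E * (\<Prod>i<?n. y i ^ E i)) = 0" by (simp add: val)
    moreover have "\<forall>E\<in>?A. \<forall>i\<ge>?n. E i = 0"
      using n by (auto simp: nth_default_def)
    ultimately have "mono_coeff p E = 0" if "E \<in> ?A" for E
      using monomials_independent[of ?A ?n "\<lambda>_. 0" "mono_coeff p" E] that by blast
    then show "lp_is_zero p" by (simp add: lp_is_zero_iff)
  qed
qed

section \<open>Lists of terms and polynomial functions\<close>

lemma lp_val_in_poly_funs:
  assumes "\<forall>t\<in>set p. length (fst t) \<le> n"
  shows "lp_val p \<in> poly_funs n"
proof -
  note R = subringD[OF subring_poly_funs[of n]]
  have power: "f ^ k \<in> poly_funs n" if "f \<in> poly_funs n" for f k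
    by (induction k) (use R that in \<open>simp_all only: power_0 power_Suc\<close>)
  have mono: "(\<lambda>y. \<Prod>i<k. y i ^ es ! i) \<in> poly_funs n" if "k \<le> n" for es k
    using that
  proof (induction k)
    case 0
    show ?case by (simp add: const_in_poly_funs)
  next
    case (Suc k)
    have "((\<lambda>y. y k :: rat) ^ m) y = y k ^ m" for m y
      by (induction m) simp_all
    then have "(\<lambda>y. y k ^ m) = (\<lambda>y. y k :: rat) ^ m" for m
      by (simp add: fun_eq_iff)
    then have "(\<lambda>y. y k ^ (es ! k)) \<in> poly_funs n"
      using power[OF proj_in_poly_funs, of k] Suc.prems by simp
    from R(3)[OF Suc.IH this] show ?case using Suc.prems by (simp add: times_fun_def)
  qed
  show ?thesis
    using assms
  proof (induction p)
    case Nil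
    show ?case by (simp add: lp_val_def const_in_poly_funs)
  next
    case (Cons t p)
    have eq: "lp_val (t # p) = (\<lambda>_. frac_val (snd t)) * mono_val (fst t) + lp_val p"
      by (simp add: fun_eq_iff lp_val_def)
    have t: "mono_val (fst t) \<in> poly_funs n"
      using mono[of "length (fst t)" "fst t"] Cons.prems by (simp add: mono_val_def[abs_def])
    have p: "lp_val p \<in> poly_funs n" using Cons by simp
    show ?case unfolding eq by (rule R(6)[OF R(3)[OF const_in_poly_funs t] p])
  qed
qed

text \<open>The coefficients of an ideal combination are at first only functions; this turns them
  into data that a search can find.\<close>

lemma poly_funs_imp_lp_val: "f \<in> poly_funs n \<Longrightarrow> \<exists>p. f = lp_val p"
proof (induction n arbitrary: f)
  case 0
  then obtain c where "f = (\<lambda>_. c)" by auto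
  then have "f = lp_val (lp_const (frac_of_rat c))" by (simp add: fun_eq_iff)
  then show ?case ..
next
  case (Suc n)
  then obtain q where q: "q \<in> polys_over (poly_funs n)" "f = poly q (\<lambda>y. y n)"
    by (auto simp: adjoin_def)
  have "\<exists>p. poly q (\<lambda>y. y n) = lp_val p"
    using q(1)
  proof (induction q)
    case 0
    have "poly 0 (\<lambda>y. y n) = lp_val []" by (simp add: fun_eq_iff)
    then show ?case ..
  next
    case (pCons a q)
    have "a \<in> poly_funs n" "q \<in> polys_over (poly_funs n)"
      using pCons.prems by (auto simp: polys_over_def coeff_pCons split: nat.splits)
    then obtain p p' where p: "a = lp_val p" "poly q (\<lambda>y. y n) = lp_val p'"
      using Suc.IH pCons.IH by blast
    \<comment> \<open>The variable of index \<open>n\<close> with coefficient (1 - 0) / (0 + 1), for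
      one Horner step.\<close>
    let ?x = "[(replicate n 0 @ [1], (1, 0, 0))] :: list_poly"
    have "lp_val ?x y = y n" for y
      by (simp add: lp_val_def frac_val_def mono_val_def nth_append)
    then have "poly (pCons a q) (\<lambda>y. y n) = lp_val (p @ lp_mult ?x p')"
      by (simp add: fun_eq_iff p)
    then show ?case ..
  qed
  then show ?case by (simp add: q(2))
qed

lemma poly_fun_subst:
  assumes "f \<in> poly_funs m" "\<And>i. h i \<in> poly_funs n"
  shows "(\<lambda>y. f (\<lambda>i. h i y)) \<in> poly_funs n"
  using assms(1)
proof (induction m arbitrary: f)
  case 0
  then show ?case by (auto simp: const_in_poly_funs)
next
  case (Suc m)
  note R = subringD[OF subring_poly_funs[of n]]
  obtain q where q: "q \<in> polys_over (poly_funs m)" "f = poly q (\<lambda>y. y m)"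
    using Suc.prems by (auto simp: adjoin_def)
  have "(\<lambda>y. poly q (\<lambda>y. y m) (\<lambda>i. h i y)) \<in> poly_funs n"
    using q(1)
  proof (induction q)
    case 0
    show ?case by (simp add: const_in_poly_funs)
  next
    case (pCons a q)
    have a: "a \<in> poly_funs m" and q: "q \<in> polys_over (poly_funs m)"
      using pCons.prems by (auto simp: polys_over_def coeff_pCons split: nat.splits)
    show ?case
      using R(6)[OF Suc.IH[OF a] R(3)[OF assms(2)[of m] pCons.IH[OF q]]]
      by (simp add: plus_fun_def times_fun_def)
  qed
  then show ?case by (simp add: q(2))
qed

section \<open>Computability of polynomial arithmetic\<close>

lemma computable_lp_const [computable_intros]:
  assumes "computable f"
  shows "computable (\<lambda>e. lp_const (f e))"
  unfolding lp_const_def by (intro computable_intros assms)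

lemma computable_lp_uminus [computable_intros]:
  assumes "computable f"
  shows "computable (\<lambda>e. lp_uminus (f e))"
  unfolding lp_uminus_def by (intro computable_intros assms)

text \<open>\<open>f\<close> and \<open>g\<close> also occur under the binder of \<open>map\<close>,
  where the environment is the first component of a pair; hence the composed copies of the
  assumptions, here and below.\<close>

lemma computable_mono_mult [computable_intros]:
  assumes "computable f" "computable g"
  shows "computable (\<lambda>e. mono_mult (f e) (g e))"
  unfolding mono_mult_def
  by (intro computable_intros assms computable_compose[OF assms(1)] computable_compose[OF assms(2)])

lemma computable_mono_eq [computable_intros]:
  assumes "computable f" "computable g"
  shows "computable (\<lambda>e. mono_eq (f e) (g e))"
  unfolding mono_eq_def
  by (intro computable_intros assms computable_compose[OF assms(1)] computable_compose[OF assms(2)])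

lemma computable_lp_mult [computable_intros]:
  assumes "computable f" "computable g"
  shows "computable (\<lambda>e. lp_mult (f e) (g e))"
  unfolding lp_mult_def
  by (intro computable_intros assms computable_compose[OF assms(1)] computable_compose[OF assms(2)])

lemma computable_lp_power [computable_intros]:
  assumes "computable f" "computable g"
  shows "computable (\<lambda>e. lp_power (f e) (g e))"
  unfolding lp_power_def
  by (intro computable_intros assms computable_compose[OF assms(1)])

lemma computable_lp_subst [computable_intros]:
  assumes "computable f" "computable g"
  shows "computable (\<lambda>e. lp_subst (f e) (g e))"
  unfolding lp_subst_def
  by (intro computable_intros assms computable_compose[OF assms(2)])

lemma computable_lp_is_zero [computable_intros]:
  assumes "computable f"
  shows "computable (\<lambda>e. lp_is_zero (f e))"
  unfolding lp_is_zero_def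
  by (intro computable_intros assms computable_compose[OF assms(1)])


section \<open>Refutations and certificates\<close>

definition step_poly :: "list_poly \<Rightarrow> list_poly \<Rightarrow> list_poly list \<Rightarrow> list_poly" where
  "step_poly H p F = lp_mult H (lp_subst p F)"

text \<open>
  The value of this polynomial at a point is the product of the values of the guard along the
  run described by \<open>w\<close>, excluding the last point, and of the value of \<open>g\<close> at the last point.
\<close>

definition word_poly ::
  "list_poly \<Rightarrow> list_poly list list \<Rightarrow> list_poly \<Rightarrow> nat list \<Rightarrow> list_poly" where
  "word_poly H Fs g w = foldr (\<lambda>i p. step_poly H p (nth_default [] Fs i)) w g"

text \<open>Missing coefficients count as 0, so a search may try coefficient lists of any
  length.\<close>

definition lp_comb :: "list_poly list \<Rightarrow> list_poly list \<Rightarrow> list_poly" where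
  "lp_comb cs qs =
     concat (map (\<lambda>i. lp_mult (nth_default [] cs i) (nth_default [] qs i)) [0..<length qs])"

definition const_point :: "rat list \<Rightarrow> list_poly list" where
  "const_point a = map (\<lambda>q. lp_const (frac_of_rat q)) a"

text \<open>Evaluation at \<open>a\<close> is substitution of constant polynomials, so the zero test
  for polynomials also tests values.\<close>

definition vanishes :: "rat list \<Rightarrow> list_poly \<Rightarrow> bool" where
  "vanishes a p \<longleftrightarrow> lp_is_zero (lp_subst p (const_point a))"

definition refutes ::
  "rat list \<Rightarrow> list_poly \<Rightarrow> list_poly \<Rightarrow> list_poly list list \<Rightarrow> nat list \<Rightarrow> bool" where
  "refutes a g H Fs w \<longleftrightarrow> list_all (\<lambda>i. i < length Fs) w \<and> \<not> vanishes a (word_poly H Fs g w)"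

text \<open>\<open>css\<close> is an unordered pool: a certificate does not have to say which
  coefficient list belongs to which pair of polynomial and map.\<close>

definition certifies ::
  "rat list \<Rightarrow> list_poly \<Rightarrow> list_poly \<Rightarrow> list_poly list list \<Rightarrow>
     list_poly list \<Rightarrow> list_poly list list \<Rightarrow> bool" where
  "certifies a g H Fs ps css \<longleftrightarrow>
     list_all (\<lambda>q. vanishes a q \<and>
       list_all (\<lambda>F. list_ex (\<lambda>cs. lp_is_zero (step_poly H q F @ lp_uminus (lp_comb cs (g # ps)))) css)
         Fs) (g # ps)"

definition apply_map :: "list_poly list \<Rightarrow> (nat \<Rightarrow> rat) \<Rightarrow> nat \<Rightarrow> rat" where
  "apply_map F y i = lp_val (nth_default [] F i) y"

lemma lp_val_step_poly: "lp_val (step_poly H p F) y = lp_val H y * lp_val p (apply_map F y)"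
  by (simp add: step_poly_def lp_val_subst apply_map_def[abs_def])

lemma word_poly_simps [simp]:
  "word_poly H Fs g [] = g"
  "word_poly H Fs g (i # w) = step_poly H (word_poly H Fs g w) (nth_default [] Fs i)"
  by (simp_all add: word_poly_def)

lemma lp_val_comb:
  "lp_val (lp_comb cs qs) y = (\<Sum>i<length qs. lp_val (nth_default [] cs i) y * lp_val (qs ! i) y)"
  by (simp add: lp_comb_def lp_val_concat o_def interv_sum_list_conv_sum_set_nat
      lessThan_atLeast0 nth_default_def)

lemma vanishes_iff: "vanishes a p \<longleftrightarrow> lp_val p (nth_default 0 a) = 0"
proof -
  have "lp_val (nth_default [] (const_point a) i) y = nth_default 0 a i" for i y
    by (simp add: const_point_def nth_default_def)
  then show ?thesis by (simp add: vanishes_def lp_is_zero_iff_val lp_val_subst)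
qed

text \<open>Where the guard is nonzero, every map sends common zeros of \<open>g # ps\<close> to
  common zeros. As \<open>a\<close> is one of them, along each run either the guard vanishes or
  \<open>g\<close> vanishes at the end.\<close>

lemma certifies_not_refutes:
  assumes "certifies a g H Fs ps css"
  shows "\<not> refutes a g H Fs w"
proof -
  let ?Z = "\<lambda>y. \<forall>q\<in>set (g # ps). lp_val q y = 0"
  have step: "lp_val H y = 0 \<or> ?Z (apply_map (nth_default [] Fs i) y)"
    if Z: "?Z y" and i: "i < length Fs" for y i
    unfolding disj_imp
  proof (intro impI ballI)
    fix q assume H: "lp_val H y \<noteq> 0" and q: "q \<in> set (g # ps)"
    have "nth_default [] Fs i \<in> set Fs" using i by (simp add: nth_default_def)
    then obtain cs where
      "lp_is_zero (step_poly H q (nth_default [] Fs i) @ lp_uminus (lp_comb cs (g # ps)))"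
      using assms q unfolding certifies_def list_all_iff list_ex_iff by blast
    then have "lp_val (step_poly H q (nth_default [] Fs i)) y = lp_val (lp_comb cs (g # ps)) y"
      by (simp add: lp_is_zero_iff_val)
    also have "\<dots> = 0"
      unfolding lp_val_comb using Z by (intro sum.neutral) (simp del: list.set)
    finally show "lp_val q (apply_map (nth_default [] Fs i) y) = 0"
      using H by (simp add: lp_val_step_poly)
  qed
  have "lp_val (word_poly H Fs g w) y = 0" if "?Z y" "list_all (\<lambda>i. i < length Fs) w" for y
    using that
  proof (induction w arbitrary: y)
    case (Cons i w)
    have "i < length Fs" "list_all (\<lambda>i. i < length Fs) w" using Cons.prems(2) by simp_all
    then show ?case
      using step[OF Cons.prems(1)] Cons.IH by (fastforce simp: lp_val_step_poly)
  qed simp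
  moreover have "?Z (nth_default 0 a)"
    using assms by (auto simp: certifies_def list_all_iff vanishes_iff)
  ultimately show ?thesis by (auto simp: refutes_def vanishes_iff)
qed

lemma combinations_imp_lp_comb:
  assumes "f \<in> combinations (poly_funs n) (lp_val ` set qs)"
  shows "\<exists>cs. f = lp_val (lp_comb cs qs)"
  using assms
proof induction
  case zero
  have "0 = lp_val (lp_comb [] qs)" by (simp add: fun_eq_iff lp_val_comb)
  then show ?case ..
next
  case (add f s g)
  then obtain cs c j where cs: "f = lp_val (lp_comb cs qs)" and c: "s = lp_val c"
    and j: "j < length qs" "g = lp_val (qs ! j)"
    by (metis imageE in_set_conv_nth poly_funs_imp_lp_val)
  \<comment> \<open>Appending adds polynomials, so \<open>c\<close> is added to coefficient
    \<open>j\<close>, which may already be nonzero.\<close>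
  let ?cs = "map (\<lambda>i. nth_default [] cs i @ (if i = j then c else [])) [0..<length qs]"
  have "lp_val (lp_comb ?cs qs) y =
      (\<Sum>i<length qs. lp_val (nth_default [] cs i) y * lp_val (qs ! i) y +
        (if j = i then lp_val c y * lp_val (qs ! j) y else 0))" for y
    unfolding lp_val_comb by (intro sum.cong) (auto simp: nth_default_def algebra_simps)
  then have "f + s * g = lp_val (lp_comb ?cs qs)"
    using j by (simp add: fun_eq_iff cs c sum.distrib lp_val_comb)
  then show ?case ..
qed

lemma lp_val_step_poly_in_poly_funs:
  assumes "lp_val H \<in> poly_funs n" "lp_val p \<in> poly_funs n" "\<forall>f\<in>set F. lp_val f \<in> poly_funs n"
  shows "lp_val (step_poly H p F) \<in> poly_funs n"
proof -
  have "(\<lambda>y. lp_val (nth_default [] F i) y) \<in> poly_funs n" for i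
    using assms(3) const_in_poly_funs[of 0 n] by (cases "i < length F") (simp_all add: nth_default_def)
  from poly_fun_subst[OF assms(2) this]
  have "(\<lambda>y. lp_val p (apply_map F y)) \<in> poly_funs n"
    by (simp add: apply_map_def[abs_def])
  from subringD(3)[OF subring_poly_funs assms(1) this] show ?thesis
    by (simp add: times_fun_def lp_val_step_poly[abs_def])
qed

text \<open>Without a refutation every word polynomial with valid indices vanishes at
  \<open>a\<close>, and finitely many that generate all of them, together with \<open>g\<close>,
  form a certificate.\<close>

theorem refutes_or_certifies: "\<exists>w ps css. refutes a g H Fs w \<or> certifies a g H Fs ps css"
proof (cases "\<exists>w. refutes a g H Fs w")
  case False
  let ?W = "lists {..<length Fs}"
  \<comment> \<open>The number of variables \<open>n\<close> is read off the exponent lists at hand,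
    rather than taken from the loop.\<close>
  let ?L = "\<Union>p\<in>{g, H} \<union> (\<Union>F\<in>set Fs. set F). length ` fst ` set p"
  define n where "n = Max (insert 0 ?L)"
  have "finite (insert 0 ?L)" by simp
  then have n: "k \<le> n" if "k \<in> ?L" for k
    unfolding n_def using that by (intro Max_ge) auto
  have in_funs: "lp_val p \<in> poly_funs n" if "p \<in> {g, H} \<union> (\<Union>F\<in>set Fs. set F)" for p
  proof (rule lp_val_in_poly_funs, rule ballI)
    fix t assume "t \<in> set p"
    then have "length (fst t) \<in> ?L" using that by blast
    then show "length (fst t) \<le> n" by (rule n)
  qed
  have "lp_val (word_poly H Fs g w) \<in> poly_funs n" if "w \<in> ?W" for w
    using that
  proof induction
    case Nil
    show ?case using in_funs by simp
  next
    case (Cons i w)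
    then have "\<forall>f\<in>set (Fs ! i). lp_val f \<in> poly_funs n"
      by (intro ballI in_funs) auto
    moreover have "lp_val H \<in> poly_funs n" by (rule in_funs) simp
    ultimately show ?case
      using Cons by (simp add: lp_val_step_poly_in_poly_funs nth_default_def)
  qed
  then have "(\<lambda>w. lp_val (word_poly H Fs g w)) ` ?W \<subseteq> poly_funs n" by blast
  then obtain G0 where G0: "G0 \<subseteq> (\<lambda>w. lp_val (word_poly H Fs g w)) ` ?W" "finite G0"
    "(\<lambda>w. lp_val (word_poly H Fs g w)) ` ?W \<subseteq> combinations (poly_funs n) G0"
    using noetherian_poly_funs[of n] unfolding noetherian_def by meson
  then obtain W where W: "W \<subseteq> ?W" "finite W" "G0 = (\<lambda>w. lp_val (word_poly H Fs g w)) ` W"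
    by (meson finite_subset_image)
  obtain ws where ws: "set ws = W" using finite_list[OF W(2)] by blast
  let ?ps = "map (word_poly H Fs g) ws"
  have ps: "\<exists>w\<in>?W. q = word_poly H Fs g w" if "q \<in> set (g # ?ps)" for q
    using that W(1) ws by (auto intro: bexI[of _ "[]"])
  have "\<exists>cs. lp_is_zero (step_poly H q F @ lp_uminus (lp_comb cs (g # ?ps)))"
    if q: "q \<in> set (g # ?ps)" and F: "F \<in> set Fs" for q F
  proof -
    obtain w where w: "w \<in> ?W" "q = word_poly H Fs g w" using ps[OF q] by blast
    obtain i where i: "i < length Fs" "F = Fs ! i" using F by (auto simp: in_set_conv_nth)
    \<comment> \<open>A step from a word polynomial is the word polynomial of a longer word, so it
      lies in the ideal generated by \<open>G0\<close>.\<close>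
    have "step_poly H q F = word_poly H Fs g (i # w)" "i # w \<in> ?W"
      using w i by (auto simp: nth_default_def)
    then have "lp_val (step_poly H q F) \<in> combinations (poly_funs n) G0"
      using G0(3) by fastforce
    moreover have "G0 \<subseteq> lp_val ` set (g # ?ps)"
      using W(3) ws by auto
    ultimately obtain cs where "lp_val (step_poly H q F) = lp_val (lp_comb cs (g # ?ps))"
      using combinations_imp_lp_comb combinations_mono by blast
    then have "lp_is_zero (step_poly H q F @ lp_uminus (lp_comb cs (g # ?ps)))"
      by (simp add: lp_is_zero_iff_val)
    then show ?thesis ..
  qed
  then obtain cs where cs: "\<And>q F. q \<in> set (g # ?ps) \<Longrightarrow> F \<in> set Fs \<Longrightarrow>
      lp_is_zero (step_poly H q F @ lp_uminus (lp_comb (cs q F) (g # ?ps)))"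
    by metis
  let ?css = "concat (map (\<lambda>q. map (cs q) Fs) (g # ?ps))"
  have "vanishes a q" if "q \<in> set (g # ?ps)" for q
    using False ps[OF that] by (auto simp: refutes_def list_all_iff)
  moreover have "\<exists>c\<in>set ?css. lp_is_zero (step_poly H q F @ lp_uminus (lp_comb c (g # ?ps)))"
    if "q \<in> set (g # ?ps)" "F \<in> set Fs" for q F
  proof (rule bexI[of _ "cs q F"])
    show "cs q F \<in> set ?css"
      unfolding set_concat set_map
      by (rule UnionI[OF imageI[OF imageI[OF that(1)]]]) (simp add: that(2))
  qed (rule cs[OF that])
  ultimately have "certifies a g H Fs ?ps ?css"
    unfolding certifies_def list_all_iff list_ex_iff by blast
  then show ?thesis by blast
qed blast

section \<open>The search as a computable function\<close>

lemma computable_step_poly [computable_intros]: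
  assumes "computable H" "computable p" "computable F"
  shows "computable (\<lambda>e. step_poly (H e) (p e) (F e))"
  unfolding step_poly_def by (intro computable_intros assms)

lemma computable_word_poly [computable_intros]:
  assumes "computable H" "computable Fs" "computable g" "computable w"
  shows "computable (\<lambda>e. word_poly (H e) (Fs e) (g e) (w e))"
  unfolding word_poly_def
  by (intro computable_intros assms computable_compose[OF assms(1)] computable_compose[OF assms(2)])

lemma computable_lp_comb [computable_intros]:
  assumes "computable cs" "computable qs"
  shows "computable (\<lambda>e. lp_comb (cs e) (qs e))"
  unfolding lp_comb_def
  by (intro computable_intros assms computable_compose[OF assms(1)] computable_compose[OF assms(2)])

lemma computable_vanishes [computable_intros]:
  assumes "computable a" "computable p"
  shows "computable (\<lambda>e. vanishes (a e) (p e))"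
  unfolding vanishes_def const_point_def by (intro computable_intros assms)

lemma computable_refutes [computable_intros]:
  assumes "computable a" "computable g" "computable H" "computable Fs" "computable w"
  shows "computable (\<lambda>e. refutes (a e) (g e) (H e) (Fs e) (w e))"
  unfolding refutes_def by (intro computable_intros assms computable_compose[OF assms(4)])

lemma computable_certifies [computable_intros]:
  assumes "computable a" "computable g" "computable H" "computable Fs" "computable ps" "computable css"
  shows "computable (\<lambda>e. certifies (a e) (g e) (H e) (Fs e) (ps e) (css e))"
  unfolding certifies_def
  by (intro computable_intros assms assms[THEN computable_compose])

lemma computable_refutable:
  "computable (\<lambda>e. \<exists>w. refutes (fst e) (fst (snd e)) (fst (snd (snd e))) (snd (snd (snd e))) w)"
proof -
  let ?refutes = "\<lambda>e. refutes (fst e) (fst (snd e)) (fst (snd (snd e))) (snd (snd (snd e)))"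
  let ?certifies = "\<lambda>e. certifies (fst e) (fst (snd e)) (fst (snd (snd e))) (snd (snd (snd e)))"
  have "\<exists>f. computable f \<and>
      (\<forall>e. ?refutes e (fst (f e)) \<or> ?certifies e (fst (snd (f e))) (snd (snd (f e))))"
  proof (rule computable_search)
    show "computable (\<lambda>p. ?refutes (fst p) (fst (snd p)) \<or>
        ?certifies (fst p) (fst (snd (snd p))) (snd (snd (snd p))))"
      by (intro computable_intros)
    show "surj (encode :: nat list \<times> list_poly list \<times> list_poly list list \<Rightarrow> nat)"
      by (intro surj_encode_prod surj_encode_list surj_encode_nat)
    show "\<exists>z. ?refutes e (fst z) \<or> ?certifies e (fst (snd z)) (snd (snd z))" for e
      using refutes_or_certifies by (metis fst_conv snd_conv)
  qed
  then obtain f where f: "computable f"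
    "\<And>e. ?refutes e (fst (f e)) \<or> ?certifies e (fst (snd (f e))) (snd (snd (f e)))"
    by blast
  have "computable (\<lambda>e. ?refutes e (fst (f e)))"
    by (intro computable_intros f(1))
  \<comment> \<open>If the word that was found does not refute, then the certificate found with it
    is valid, and by soundness no word refutes.\<close>
  moreover have "?refutes e (fst (f e)) \<longleftrightarrow> (\<exists>w. ?refutes e w)" for e
    using f(2)[of e] certifies_not_refutes by blast
  ultimately show ?thesis by simp
qed


section \<open>Evaluation of polynomials\<close>

lemma poly_eval_superset:
  assumes "finite A" "Poly_Mapping.keys p \<subseteq> A"
  shows "poly_eval p x = (\<Sum>m\<in>A. Poly_Mapping.lookup p m *
    (\<Prod>i\<in>Poly_Mapping.keys m. (x ! i) ^ Poly_Mapping.lookup m i))"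
  unfolding poly_eval_def using assms
  by (intro sum.mono_neutral_left) (auto simp: in_keys_iff)

lemma poly_eval_0 [simp]: "poly_eval 0 x = 0"
  by (simp add: poly_eval_def)

lemma poly_eval_add: "poly_eval (p + q) x = poly_eval p x + poly_eval q x"
  by (simp add: poly_eval_superset[of "Poly_Mapping.keys p \<union> Poly_Mapping.keys q"] keys_add
      lookup_add distrib_right sum.distrib)

lemma poly_eval_sum: "poly_eval (\<Sum>i\<in>A. f i) x = (\<Sum>i\<in>A. poly_eval (f i) x)"
  by (induction A rule: infinite_finite_induct) (simp_all add: poly_eval_add)

lemma poly_eval_single:
  "poly_eval (Poly_Mapping.single m c) x =
     c * (\<Prod>i\<in>Poly_Mapping.keys m. (x ! i) ^ Poly_Mapping.lookup m i)"
  by (subst poly_eval_superset[of "{m}"]) auto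

lemma poly_eval_one [simp]: "poly_eval 1 x = 1"
  using poly_eval_single[of 0 1 x] by simp

lemma monomial_eval_add:
  fixes m m' :: "nat \<Rightarrow>\<^sub>0 nat"
  shows "(\<Prod>i\<in>Poly_Mapping.keys (m + m'). (x ! i) ^ Poly_Mapping.lookup (m + m') i) =
    (\<Prod>i\<in>Poly_Mapping.keys m. (x ! i) ^ Poly_Mapping.lookup m i) *
    (\<Prod>i\<in>Poly_Mapping.keys m'. (x ! i) ^ Poly_Mapping.lookup m' i :: 'a::comm_semiring_1)"
proof -
  let ?A = "Poly_Mapping.keys m \<union> Poly_Mapping.keys m'"
  have *: "(\<Prod>i\<in>Poly_Mapping.keys k. (x ! i) ^ Poly_Mapping.lookup k i) =
      (\<Prod>i\<in>?A. (x ! i) ^ Poly_Mapping.lookup k i)" if "Poly_Mapping.keys k \<subseteq> ?A" for k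
    using that by (intro prod.mono_neutral_left) (auto simp: in_keys_iff)
  show ?thesis
    unfolding *[OF keys_add] *[OF Un_upper1] *[OF Un_upper2]
    by (simp add: lookup_add power_add prod.distrib)
qed

lemma sum_single: "(\<Sum>m\<in>Poly_Mapping.keys p. Poly_Mapping.single m (Poly_Mapping.lookup p m)) = p"
  by (rule poly_mapping_eqI) (auto simp: lookup_sum lookup_single when_def in_keys_iff)

text \<open>The guard is evaluated as the product polynomial \<open>prod_list hs\<close>, but
  computed factor by factor.\<close>

lemma poly_eval_mult: "poly_eval (p * q) x = poly_eval p x * poly_eval q x"
proof -
  have "p * q = (\<Sum>m\<in>Poly_Mapping.keys p. \<Sum>m'\<in>Poly_Mapping.keys q.
      Poly_Mapping.single (m + m') (Poly_Mapping.lookup p m * Poly_Mapping.lookup q m'))"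
    by (subst (1 2) sum_single[symmetric]) (simp add: sum_product mult_single)
  then show ?thesis
    by (simp add: poly_eval_sum poly_eval_single monomial_eval_add)
      (simp add: poly_eval_def sum_product mult_ac)
qed

lemma lookup_complex_poly [simp]:
  "Poly_Mapping.lookup (complex_poly p) m = of_rat (Poly_Mapping.lookup p m)"
  by (simp add: complex_poly_def Poly_Mapping.map.rep_eq when_def)

lemma keys_complex_poly [simp]: "Poly_Mapping.keys (complex_poly p) = Poly_Mapping.keys p"
  by (auto simp: in_keys_iff)

lemma complex_poly_in_polys_in: "p \<in> polys_in n \<Longrightarrow> complex_poly p \<in> polys_in n"
  by (simp add: polys_in_def)

lemma poly_eval_complex_poly:
  assumes "p \<in> polys_in (length x)"
  shows "poly_eval (complex_poly p) (map of_rat x) = of_rat (poly_eval p x)"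
proof -
  \<comment> \<open>The hypothesis keeps all indices below \<open>length x\<close>, where
    \<open>!\<close> commutes with \<open>map\<close>.\<close>
  have "(\<Prod>i\<in>Poly_Mapping.keys m. (map of_rat x ! i) ^ Poly_Mapping.lookup m i) =
      (\<Prod>i\<in>Poly_Mapping.keys m. of_rat (x ! i) ^ Poly_Mapping.lookup m i :: complex)"
    if "m \<in> Poly_Mapping.keys p" for m
    using assms that by (intro prod.cong refl) (auto simp: polys_in_def subset_iff)
  then show ?thesis
    by (simp add: poly_eval_def of_rat_sum of_rat_mult of_rat_prod of_rat_power)
qed

lemma comp_eval_simps [simp]:
  "comp_eval Fs [] x = x"
  "comp_eval Fs (i # is) x = comp_eval Fs is (map_eval (Fs ! i) x)"
  by (simp_all add: comp_eval_def)

lemma length_comp_eval: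
  assumes "\<forall>F\<in>set Fs. length F = n" "set is \<subseteq> {..<length Fs}" "length x = n"
  shows "length (comp_eval Fs is x) = n"
  using assms(2,3)
  by (induction "is" arbitrary: x) (simp_all add: map_eval_def assms(1))

lemma comp_eval_complex_poly:
  assumes Fs: "\<forall>F\<in>set Fs. length F = n \<and> set F \<subseteq> polys_in n"
    and "set is \<subseteq> {..<length Fs}" "length x = n"
  shows "comp_eval (map (map complex_poly) Fs) is (map of_rat x) = map of_rat (comp_eval Fs is x)"
  using assms(2,3)
proof (induction "is" arbitrary: x)
  case (Cons i "is")
  then have F: "length (Fs ! i) = n" "set (Fs ! i) \<subseteq> polys_in n" using Fs by auto
  have "map_eval (map (map complex_poly) Fs ! i) (map of_rat x) = map of_rat (map_eval (Fs ! i) x)"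
    using Cons.prems F by (auto simp: map_eval_def intro!: poly_eval_complex_poly)
  moreover have "length (map_eval (Fs ! i) x) = n"
    by (simp add: map_eval_def F)
  ultimately show ?case using Cons by simp
qed simp

text \<open>In a field the product is nonzero exactly if the guard is nonzero at every point before
  the last and \<open>g\<close> is nonzero at the last, that is, if \<open>w\<close> is a run on
  which the invariant fails.\<close>

lemma is_loop_invariant_iff:
  "is_loop_invariant a hs Fs g \<longleftrightarrow> (\<forall>w\<in>lists {..<length Fs}.
     (\<Prod>l<length w. poly_eval (prod_list hs) (comp_eval Fs (take l w) a)) *
       poly_eval g (comp_eval Fs w a) = (0::complex))"
  (is "_ \<longleftrightarrow> (\<forall>w\<in>?W. ?P w = 0)")
proof
  assume inv: "is_loop_invariant a hs Fs g"
  show "\<forall>w\<in>?W. ?P w = 0"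
  proof (rule ballI, rule ccontr)
    fix w assume w: "w \<in> ?W" "?P w \<noteq> 0"
    then have h: "poly_eval (prod_list hs) (comp_eval Fs (take l w) a) \<noteq> 0" if "l < length w" for l
      using that by auto
    have g: "poly_eval g (comp_eval Fs w a) \<noteq> 0" using w(2) by auto
    \<comment> \<open>The initial point is covered by a separate conjunct, as the positions in the
      definition start at 1.\<close>
    then have "w \<noteq> []" using inv by (auto simp: is_loop_invariant_def)
    then have "length w \<in> {1..length w}" by (cases w) auto
    moreover have "set w \<subseteq> {..<length Fs}" using w(1) by auto
    ultimately show False
      using inv h g unfolding is_loop_invariant_def by (metis order_refl take_all)
  qed
next
  assume *: "\<forall>w\<in>?W. ?P w = 0"
  show "is_loop_invariant a hs Fs g"
    unfolding is_loop_invariant_def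
  proof (intro conjI allI impI)
    show "poly_eval g a = 0" using *[rule_format, of "[]"] by simp
    fix m and w :: "nat list" assume w: "length w = m \<and> set w \<subseteq> {..<length Fs}"
    let ?g = "\<lambda>j. poly_eval g (comp_eval Fs (take j w) a)"
    show "(\<forall>j\<in>{1..m}. ?g j = 0) \<or> (\<exists>l<m. (\<forall>j\<in>{1..l}. ?g j = 0) \<and>
        poly_eval (prod_list hs) (comp_eval Fs (take l w) a) = 0)"
    proof (rule disjCI)
      assume "\<not> (\<exists>l<m. (\<forall>j\<in>{1..l}. ?g j = 0) \<and>
        poly_eval (prod_list hs) (comp_eval Fs (take l w) a) = 0)"
      then have h: "poly_eval (prod_list hs) (comp_eval Fs (take l w) a) \<noteq> 0"
        if "l < m" "\<forall>j\<in>{1..l}. ?g j = 0" for l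
        using that by blast
      \<comment> \<open>\<open>g\<close> vanishes at the earlier positions, so by \<open>h\<close>
        the guard is nonzero before \<open>j\<close>; the zero product for the prefix
        \<open>take j w\<close> then leaves only its factor \<open>g\<close>.\<close>
      have "?g j = 0" if "j \<le> m" "1 \<le> j" for j
        using that
      proof (induction j rule: less_induct)
        case (less j)
        have "poly_eval (prod_list hs) (comp_eval Fs (take l (take j w)) a) \<noteq> 0" if "l < j" for l
        proof -
          have "\<forall>i\<in>{1..l}. ?g i = 0" using less that by auto
          then show ?thesis using h[of l] that less.prems by simp
        qed
        moreover have "take j w \<in> ?W" using w set_take_subset[of j w] by auto
        ultimately show ?case
          using *[rule_format, of "take j w"] w less.prems by auto
      qed
      then show "\<forall>j\<in>{1..m}. ?g j = 0" by auto
    qed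
  qed
qed


section \<open>Decoding the input\<close>

definition lp_of_terms :: "(nat list \<times> rat) list \<Rightarrow> list_poly" where
  "lp_of_terms ts = map (\<lambda>t. (fst t, frac_of_rat (snd t))) ts"

text \<open>An intermediate form whose \<open>encode\<close> is exactly \<open>poly_code\<close>;
  the conversion to \<open>list_poly\<close> by \<open>lp_of_terms\<close> is left to the
  program.\<close>

definition poly_terms :: "nat \<Rightarrow> rat mpoly \<Rightarrow> (nat list \<times> rat) list" where
  "poly_terms n p =
     map (\<lambda>(m, c). (map (Poly_Mapping.lookup m) [0..<n], c)) (Poly_Mapping.items p)"

lemma encode_map: "encode (map f xs) = list_encode (map (\<lambda>x. encode (f x)) xs)"
  by (simp add: encode_list_def o_def)

lemma encode_poly_terms: "encode (poly_terms n p) = poly_code n p"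
  unfolding poly_terms_def poly_code_def encode_map split_def encode_prod_def encode_rat_def
    monomial_code_def encode_nat_def fst_conv snd_conv ..

lemma encode_point: "encode a = point_code a"
  by (simp add: encode_list_def point_code_def encode_rat_def)

lemma encode_polys: "encode (map (poly_terms n) ps) = polys_code n ps"
  unfolding encode_map encode_poly_terms polys_code_def ..

lemma encode_maps: "encode (map (map (poly_terms n)) Fs) = maps_code n Fs"
  by (subst encode_map) (simp only: encode_polys maps_code_def)

lemma lp_val_poly_terms:
  assumes "p \<in> polys_in n" "length x = n"
  shows "lp_val (lp_of_terms (poly_terms n p)) (nth_default 0 x) = poly_eval p x"
proof -
  have "mono_val (map (Poly_Mapping.lookup m) [0..<n]) (nth_default 0 x) =
      (\<Prod>i\<in>Poly_Mapping.keys m. (x ! i) ^ Poly_Mapping.lookup m i)"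
    if "m \<in> Poly_Mapping.keys p" for m
  proof -
    have "mono_val (map (Poly_Mapping.lookup m) [0..<n]) (nth_default 0 x) =
        (\<Prod>i<n. (x ! i) ^ Poly_Mapping.lookup m i)"
      using assms(2) by (auto simp: mono_val_def nth_default_def intro!: prod.cong)
    also have "\<dots> = (\<Prod>i\<in>Poly_Mapping.keys m. (x ! i) ^ Poly_Mapping.lookup m i)"
      using assms(1) that by (intro prod.mono_neutral_right) (auto simp: polys_in_def in_keys_iff)
    finally show ?thesis .
  qed
  then show ?thesis
    by (simp add: lp_of_terms_def poly_terms_def lp_val_def poly_eval_def Poly_Mapping.items_def
        o_def case_prod_beta sum.distinct_set_conv_list[symmetric] sum_list_distinct_conv_sum_set)
qed

definition guard_poly :: "(nat list \<times> rat) list list \<Rightarrow> list_poly" where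
  "guard_poly hs = foldr (\<lambda>h r. lp_mult (lp_of_terms h) r) hs lp_one"

lemma lp_val_guard_poly:
  assumes "set hs \<subseteq> polys_in n" "length x = n"
  shows "lp_val (guard_poly (map (poly_terms n) hs)) (nth_default 0 x) = poly_eval (prod_list hs) x"
  using assms(1)
  by (induction hs) (simp_all add: guard_poly_def poly_eval_mult lp_val_poly_terms assms(2))

text \<open>Induction on \<open>w\<close> for all points: the first step splits off the guard at
  \<open>x\<close> and continues from the image of \<open>x\<close>.\<close>

lemma lp_val_word_poly:
  fixes Fs :: "rat mpoly list list"
  assumes g: "g \<in> polys_in n" and hs: "set hs \<subseteq> polys_in n"
    and Fs: "\<forall>F\<in>set Fs. length F = n \<and> set F \<subseteq> polys_in n"
    and "set w \<subseteq> {..<length Fs}" "length x = n"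
  shows "lp_val (word_poly (guard_poly (map (poly_terms n) hs))
      (map (map (\<lambda>p. lp_of_terms (poly_terms n p))) Fs) (lp_of_terms (poly_terms n g)) w)
      (nth_default 0 x) =
    (\<Prod>l<length w. poly_eval (prod_list hs) (comp_eval Fs (take l w) x)) *
      poly_eval g (comp_eval Fs w x)"
  using assms(4,5)
proof (induction w arbitrary: x)
  case Nil
  then show ?case by (simp add: lp_val_poly_terms g)
next
  case (Cons i w)
  then have i: "i < length Fs" and F: "length (Fs ! i) = n" "set (Fs ! i) \<subseteq> polys_in n"
    using Fs by auto
  have "apply_map (nth_default [] (map (map (\<lambda>p. lp_of_terms (poly_terms n p))) Fs) i)
      (nth_default 0 x) = nth_default 0 (map_eval (Fs ! i) x)"
  proof
    fix j
    show "apply_map (nth_default [] (map (map (\<lambda>p. lp_of_terms (poly_terms n p))) Fs) i)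
      (nth_default 0 x) j = nth_default 0 (map_eval (Fs ! i) x) j"
    proof (cases "j < n")
      case True
      then have "Fs ! i ! j \<in> polys_in n" using F by auto
      then show ?thesis
        using True i F Cons.prems(2)
        by (simp add: apply_map_def nth_default_def[of _ _ i] nth_default_def[of _ _ j]
            map_eval_def lp_val_poly_terms)
    next
      \<comment> \<open>Beyond the first \<open>n\<close> coordinates both sides are 0: the missing
        component is the zero polynomial and the missing coordinate has default 0.\<close>
      case False
      then show ?thesis
        using i F by (simp add: apply_map_def nth_default_def[of _ _ i] nth_default_def[of _ _ j]
            map_eval_def)
    qed
  qed
  moreover have "length (map_eval (Fs ! i) x) = n" by (simp add: map_eval_def F)
  ultimately show ?case
    using Cons hs
    by (simp add: lp_val_step_poly lp_val_guard_poly prod.lessThan_Suc_shift del: prod.lessThan_Suc)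
qed

text \<open>All values along a run are images of rationals under the injective
  \<open>of_rat\<close>, so vanishing over the complex numbers is vanishing over the
  rationals.\<close>

lemma refutable_iff_not_invariant:
  assumes a: "length a = n" and g: "g \<in> polys_in n" and hs: "set hs \<subseteq> polys_in n"
    and Fs: "\<forall>F\<in>set Fs. length F = n \<and> set F \<subseteq> polys_in n"
  shows "(\<exists>w. refutes a (lp_of_terms (poly_terms n g)) (guard_poly (map (poly_terms n) hs))
      (map (map (\<lambda>p. lp_of_terms (poly_terms n p))) Fs) w) \<longleftrightarrow>
    complex_poly g \<notin> loop_invariants (map of_rat a) (map complex_poly hs)
      (map (map complex_poly) Fs)"
proof -
  let ?Fs = "map (map complex_poly) Fs"
  let ?P = "\<lambda>w. (\<Prod>l<length w. poly_eval (prod_list hs) (comp_eval Fs (take l w) a)) *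
    poly_eval g (comp_eval Fs w a)"
  have g': "poly_eval (complex_poly g) (map of_rat x) = of_rat (poly_eval g x)"
    and h': "poly_eval (prod_list (map complex_poly hs)) (map of_rat x) =
      of_rat (poly_eval (prod_list hs) x)" if "length x = n" for x
  proof -
    show "poly_eval (complex_poly g) (map of_rat x) = of_rat (poly_eval g x)"
      using that g by (simp add: poly_eval_complex_poly)
    show "poly_eval (prod_list (map complex_poly hs)) (map of_rat x) =
        of_rat (poly_eval (prod_list hs) x)"
      using hs by (induction hs) (simp_all add: poly_eval_mult poly_eval_complex_poly that of_rat_mult)
  qed
  have *: "(\<Prod>l<length w. poly_eval (prod_list (map complex_poly hs))
        (comp_eval ?Fs (take l w) (map of_rat a))) *
      poly_eval (complex_poly g) (comp_eval ?Fs w (map of_rat a)) = of_rat (?P w)"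
    if "w \<in> lists {..<length Fs}" for w
  proof -
    have w: "set w \<subseteq> {..<length Fs}" using that by auto
    have len: "length (comp_eval Fs v a) = n"
      and ev: "comp_eval ?Fs v (map of_rat a) = map of_rat (comp_eval Fs v a)"
      if "set v \<subseteq> {..<length Fs}" for v
      using length_comp_eval[of Fs n v a] comp_eval_complex_poly[OF Fs that a] that Fs a by auto
    have take: "set (take l w) \<subseteq> {..<length Fs}" for l
      using w set_take_subset[of l w] by blast
    show ?thesis
      by (simp add: ev[OF w] ev[OF take] g'[OF len[OF w]] h'[OF len[OF take]] of_rat_mult of_rat_prod)
  qed
  have "complex_poly g \<in> loop_invariants (map of_rat a) (map complex_poly hs) ?Fs \<longleftrightarrow>
      is_loop_invariant (map of_rat a) (map complex_poly hs) ?Fs (complex_poly g)"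
    using complex_poly_in_polys_in[OF g] a by (simp add: loop_invariants_def)
  also have "\<dots> \<longleftrightarrow> (\<forall>w\<in>lists {..<length Fs}. ?P w = 0)"
    unfolding is_loop_invariant_iff length_map
    by (intro ball_cong refl) (simp only: * of_rat_eq_0_iff)
  finally have "complex_poly g \<in> loop_invariants (map of_rat a) (map complex_poly hs) ?Fs \<longleftrightarrow>
      (\<forall>w\<in>lists {..<length Fs}. ?P w = 0)" .
  moreover have "refutes a (lp_of_terms (poly_terms n g)) (guard_poly (map (poly_terms n) hs))
      (map (map (\<lambda>p. lp_of_terms (poly_terms n p))) Fs) w \<longleftrightarrow>
      w \<in> lists {..<length Fs} \<and> ?P w \<noteq> 0" for w
    unfolding refutes_def vanishes_iff
    using lp_val_word_poly[OF g hs Fs _ a, of w] by (auto simp: list_all_iff subset_iff)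
  ultimately show ?thesis by blast
qed

theorem theorem4p16:
  "\<exists>P. \<forall>(n::nat) (a::rat list) (g::rat mpoly) (hs::rat mpoly list) (Fs::rat mpoly list list).
     length a = n \<and> g \<in> polys_in n \<and> set hs \<subseteq> polys_in n \<and>
     (\<forall>F\<in>set Fs. length F = n \<and> set F \<subseteq> polys_in n) \<longrightarrow>
     computes P [point_code a, poly_code n g, polys_code n hs, maps_code n Fs]
       (if complex_poly g \<in> loop_invariants (map of_rat a) (map complex_poly hs)
             (map (map complex_poly) Fs)
        then 1 else 0)"
proof -
  define input where "input e = (fst e, lp_of_terms (fst (snd e)), guard_poly (fst (snd (snd e))),
      map (map lp_of_terms) (snd (snd (snd e))))"
    for e :: "rat list \<times> (nat list \<times> rat) list \<times> (nat list \<times> rat) list list \<times>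
      (nat list \<times> rat) list list list"
  have "computable input"
    unfolding input_def guard_poly_def lp_of_terms_def by (intro computable_intros)
  from computable_Not[OF computable_compose[OF computable_refutable this]]
  obtain D where D: "\<And>e. computes D [encode e] (encode (\<not> (\<exists>w. refutes (fst (input e))
      (fst (snd (input e))) (fst (snd (snd (input e)))) (snd (snd (snd (input e)))) w)))"
    unfolding computable_def by blast
  obtain C where C: "\<And>x y. computes C [x, y] (prod_encode (x, y))"
    using computable2_prod_encode unfolding computable2_def by blast
  \<comment> \<open>The four arguments are paired in the nesting of the encoded tuple.
    \<open>n\<close> is not passed on, since the lists carry all that is computed with.\<close>
  let ?P = "Comp D [Comp C [Proj 0, Comp C [Proj 1, Comp C [Proj 2, Proj 3]]]]"
  show ?thesis
  proof (intro exI[of _ ?P] allI impI, elim conjE)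
    fix n :: nat and a :: "rat list" and g :: "rat mpoly" and hs :: "rat mpoly list"
      and Fs :: "rat mpoly list list"
    assume a: "length a = n" and g: "g \<in> polys_in n" and hs: "set hs \<subseteq> polys_in n"
      and Fs: "\<forall>F\<in>set Fs. length F = n \<and> set F \<subseteq> polys_in n"
    let ?e = "(a, poly_terms n g, map (poly_terms n) hs, map (map (poly_terms n)) Fs)"
    have e: "encode ?e = prod_encode (point_code a, prod_encode (poly_code n g,
        prod_encode (polys_code n hs, maps_code n Fs)))"
      by (simp add: encode_prod_def encode_point encode_poly_terms encode_polys encode_maps)
    have "computes ?P [point_code a, poly_code n g, polys_code n hs, maps_code n Fs]
        (encode (\<not> (\<exists>w. refutes (fst (input ?e)) (fst (snd (input ?e)))
          (fst (snd (snd (input ?e)))) (snd (snd (snd (input ?e)))) w)))"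
      by (rule computes_comp1[OF _ D[of ?e]], unfold e)
        (rule computes_comp2[OF _ _ C] computes_proj | simp)+
    then show "computes ?P [point_code a, poly_code n g, polys_code n hs, maps_code n Fs]
       (if complex_poly g \<in> loop_invariants (map of_rat a) (map complex_poly hs)
             (map (map complex_poly) Fs)
        then 1 else 0)"
      using refutable_iff_not_invariant[OF a g hs Fs]
      by (simp add: input_def encode_bool_def o_def)
  qed
qed

end
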